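(* The colouring matrices of the knots $9_{35}$, $9_{47}$, $9_{48}$, $9_{49}$ and $10_{157}$ cannot be triangularized; that is, for each of these knots, no triangular matrix is equivalent to its colouring matrix.
   Context: **Knot names.** Knots are named as in Rolfsen's table of prime knots up to ten crossings. **Colouring matrix.** Let $D$ be an oriented diagram of a knot with $N\ge1$ crossings, hence $N$ arcs. Its colouring matrix is the $N\times N$ matrix over $\mathbb{Z}[m,m^{-1}]$ ($m$ an indeterminate) with columns indexed by arcs and one row per crossing: at a crossing with incoming under-arc $i$, outgoing under-arc $i'$ and over-arc $j$, the row encodes $mX_i+(1-m)X_j-X_{i'}=0$ if the crossing is positive (right-handed), and $m^{-1}X_i+(1-m^{-1})X_j-X_{i'}=0$ if it is negative (left-handed); if some of $i,i',j$ coincide the corresponding entries are added. The entries in each row add up to zero. **Equivalent matrices; triangularizable.** $B$ is equivalent to a colouring matrix $A$ if it is obtained from $A$ by finitely many operations of the following kinds: (a) multiplying a row by $m$, $m^{-1}$ or $-1$; (b) replacing a row by its sum with another row; (c) swapping two rows; (d) swapping two columns. $A$ is triangularizable (can be triangularized) if some (upper) triangular matrix is equivalent to $A$. *)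

theory Defs
  imports
    "HOL-Library.Poly_Mapping"
    "HOL-Combinatorics.Orbits"
    "Jordan_Normal_Form.Column_Operations"
begin

section \<open>Oriented knot diagrams\<close>

text \<open>
  An oriented diagram is given by its signed Gauss code: walking once along the knot, one records
  for every passage through a crossing the label of the crossing, whether one is on the upper or on
  the lower strand, and the sign of the crossing (1 for right-handed, -1 for left-handed). The code
  determines the diagram on the sphere up to orientation-preserving homeomorphism, and it is
  read cyclically. The empty code is the diagram without crossings.
\<close>

datatype level = Over | Under

fun opposite :: "level \<Rightarrow> level" where
  "opposite Over = Under"
| "opposite Under = Over"

type_synonym passage = "nat \<times> level \<times> int"
type_synonym gauss_code = "passage list"

fun partner :: "passage \<Rightarrow> passage" where
  "partner (c, l, s) = (c, opposite l, s)"

definition well_formed :: "gauss_code \<Rightarrow> bool" where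
  "well_formed w \<longleftrightarrow> distinct w \<and>
     (\<forall>(c, l, s) \<in> set w. (s = 1 \<or> s = -1) \<and> (c, opposite l, s) \<in> set w \<and> (c, l, -s) \<notin> set w)"

text \<open>
  A dart \<open>(x, fwd)\<close> is the edge that leaves the passage \<open>x\<close> in the direction of the orientation
  (\<open>fwd\<close>) or against it, travelled away from \<open>x\<close>. The map \<open>face_step\<close> follows this edge to its
  other end \<open>y\<close> and turns left there, so that its orbits are the boundaries of the faces. For a
  right-handed crossing the lower strand crosses the upper one from right to left; hence travelling
  forward into \<open>y\<close>, turning left means continuing forward along the other strand exactly if \<open>y\<close> is
  the upper passage of a right-handed or the lower passage of a left-handed crossing. Travelling
  backward exchanges the two cases.
\<close>

definition next_passage :: "gauss_code \<Rightarrow> passage \<Rightarrow> passage" where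
  "next_passage w x = the (map_of (zip w (rotate1 w)) x)"

definition prev_passage :: "gauss_code \<Rightarrow> passage \<Rightarrow> passage" where
  "prev_passage w x = the (map_of (zip (rotate1 w) w) x)"

fun left_forward :: "passage \<Rightarrow> bool" where
  "left_forward (c, l, s) \<longleftrightarrow> (l = Over \<longleftrightarrow> s = 1)"

definition face_step :: "gauss_code \<Rightarrow> passage \<times> bool \<Rightarrow> passage \<times> bool" where
  "face_step w = (\<lambda>(x, fwd).
     let y = (if fwd then next_passage w x else prev_passage w x)
     in (partner y, fwd = left_forward y))"

definition faces :: "gauss_code \<Rightarrow> (passage \<times> bool) set set" where
  "faces w = orbit (face_step w) ` (set w \<times> UNIV)"

text \<open>
  A Gauss code with \<open>N\<close> crossings has \<open>2 N\<close> edges, so it is realised by a diagram on the sphere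
  if and only if it has \<open>N + 2\<close> faces (Euler characteristic 2).
\<close>

definition planar :: "gauss_code \<Rightarrow> bool" where
  "planar w \<longleftrightarrow> w = [] \<or> card (faces w) = length w div 2 + 2"

definition knot_diagram :: "gauss_code \<Rightarrow> bool" where
  "knot_diagram w \<longleftrightarrow> well_formed w \<and> planar w"


section \<open>Equivalence of diagrams\<close>

definition in_order :: "int \<Rightarrow> 'a \<Rightarrow> 'a \<Rightarrow> 'a list" where
  "in_order k x y = (if k > 0 then [x, y] else [y, x])"

text \<open>
  Three strands (top, middle, bottom) bounding a triangle, ready for a third Reidemeister move.
  The crossings are \<open>a\<close> (top over middle), \<open>b\<close> (top over bottom) and \<open>c\<close> (middle over bottom), with
  signs \<open>ea\<close>, \<open>eb\<close>, \<open>ec\<close>. Take the strands to be straight lines with directions \<open>v1\<close>, \<open>v2\<close>, \<open>v3\<close>,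
  with \<open>a\<close> at the origin and \<open>q\<close> a point of the bottom line. Then \<open>ea\<close>, \<open>eb\<close>, \<open>ec\<close> are the signs of
  \<open>det (v1, v2)\<close>, \<open>det (v1, v3)\<close>, \<open>det (v2, v3)\<close>. Let \<open>k\<close> be the sign of \<open>det (q, v3)\<close>. The parameter
  of \<open>b\<close> minus that of \<open>a\<close> on the top line is \<open>det (q, v3) / det (v1, v3)\<close>; the parameter of \<open>c\<close> minus
  that of \<open>a\<close> on the middle line is \<open>det (q, v3) / det (v2, v3)\<close>; and the parameter of \<open>c\<close> minus that
  of \<open>b\<close> on the bottom line is \<open>det (q, v3) det (v1, v2) / (det (v1, v3) det (v2, v3))\<close>, by the
  Pluecker relation. This gives the orders below; the move pushes the bottom line across
  the origin, which changes \<open>k\<close> to \<open>-k\<close> and hence reverses all three orders.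
\<close>

definition triangle :: "passage list \<Rightarrow> passage list \<Rightarrow> passage list \<Rightarrow> bool" where
  "triangle T M B \<longleftrightarrow> (\<exists>a b c ea eb ec k.
     {ea, eb, ec, k} \<subseteq> {1, -1} \<and>
     T = in_order (k * eb) (a, Over, ea) (b, Over, eb) \<and>
     M = in_order (k * ec) (a, Under, ea) (c, Over, ec) \<and>
     B = in_order (k * ea * eb * ec) (b, Under, eb) (c, Under, ec))"

text \<open>
  The first two rules account for the choice of a starting point and of crossing labels. In \<open>R2\<close>
  the two strands may be parallel or antiparallel; in \<open>R3\<close> the three strands of the triangle may
  be met in any order along the knot.
\<close>

inductive reidemeister :: "gauss_code \<Rightarrow> gauss_code \<Rightarrow> bool" where
  rotate: "reidemeister (u @ v) (v @ u)"
| relabel: "inj_on f (fst ` set w) \<Longrightarrow> reidemeister w (map (\<lambda>(c, l, s). (f c, l, s)) w)"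
| R1: "reidemeister ([(c, l, s), (c, opposite l, s)] @ u) u"
| R2: "Q = [(a, opposite l, s), (b, opposite l, -s)] \<or> Q = [(b, opposite l, -s), (a, opposite l, s)]
      \<Longrightarrow> reidemeister ([(a, l, s), (b, l, -s)] @ u @ Q @ v) (u @ v)"
| R3: "triangle T M B \<Longrightarrow> mset [P, Q, R] = mset [T, M, B] \<Longrightarrow>
      reidemeister (P @ u @ Q @ v @ R @ z) (rev P @ u @ rev Q @ v @ rev R @ z)"

definition knot_equiv :: "gauss_code \<Rightarrow> gauss_code \<Rightarrow> bool" where
  "knot_equiv = (\<lambda>D D'. knot_diagram D \<and> knot_diagram D' \<and>
                        (reidemeister D D' \<or> reidemeister D' D))\<^sup>*\<^sup>*"

text \<open>
  Reflecting the plane of the diagram preserves the Gauss code except for the crossing signs.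
  Reversing the orientation preserves the signs.
\<close>

definition mirror :: "gauss_code \<Rightarrow> gauss_code" where
  "mirror w = map (\<lambda>(c, l, s). (c, l, -s)) w"

text \<open>
  Knots are unoriented and, as in Rolfsen's table, a name stands for a knot as well as its mirror
  image. So the diagrams of the knot with reference diagram \<open>K\<close> are taken up to both symmetries.
\<close>

definition diagram_of :: "gauss_code \<Rightarrow> gauss_code \<Rightarrow> bool" where
  "diagram_of K D \<longleftrightarrow> knot_diagram D \<and>
     (\<exists>K' \<in> {K, rev K, mirror K, mirror (rev K)}. knot_equiv K' D)"


section \<open>The knots\<close>

text \<open>
  An unsigned Gauss code (\<open>c\<close> for the upper and \<open>-c\<close> for the lower passage through the crossing \<open>c\<close>)
  together with the list of the signs of the crossings 1, 2, ...
\<close>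

definition signed_code :: "int list \<Rightarrow> int list \<Rightarrow> gauss_code" where
  "signed_code g e =
     map (\<lambda>x. (nat \<bar>x\<bar>, if x > 0 then Over else Under, e ! (nat \<bar>x\<bar> - 1))) g"

text \<open>
  The first four are the diagrams with Dowker-Thistlethwaite codes
  \<open>8 12 16 14 18 4 2 6 10\<close>, \<open>6 8 10 16 14 -18 4 2 -12\<close>, \<open>4 10 -14 -12 16 2 -6 18 8\<close> and
  \<open>6 -10 -14 12 -16 -2 18 -4 -8\<close>. The last one is the closure of the 3-braid
  \<open>s1^3 s2^2 s1^-1 s2 s1^-1 s2^2\<close>. Their Alexander polynomials are, respectively,
  \<open>7 - 13 m + 7 m^2\<close>,
  \<open>1 - 4 m + 6 m^2 - 5 m^3 + 6 m^4 - 4 m^5 + m^6\<close>,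
  \<open>1 - 7 m + 11 m^2 - 7 m^3 + m^4\<close>,
  \<open>3 - 6 m + 7 m^2 - 6 m^3 + 3 m^4\<close> and
  \<open>1 - 6 m + 11 m^2 - 13 m^3 + 11 m^4 - 6 m^5 + m^6\<close>.
\<close>

definition knot_9_35 :: gauss_code where
  "knot_9_35 = signed_code
     [1, -2, 3, -4, 5, -6, 7, -1, 8, -9, 4, -3, 2, -7, 6, -5, 9, -8]
     [1, 1, 1, 1, 1, 1, 1, 1, 1]"

definition knot_9_47 :: gauss_code where
  "knot_9_47 = signed_code
     [1, -2, 3, -4, 5, -1, 6, -3, 7, -5, -8, 9, 4, -7, 2, -6, -9, 8]
     [1, -1, -1, 1, 1, 1, -1, 1, 1]"

definition knot_9_48 :: gauss_code where
  "knot_9_48 = signed_code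
     [1, -2, 3, -1, -4, 5, -6, -7, 8, -3, 2, 6, -5, 4, 9, -8, 7, -9]
     [1, -1, -1, -1, -1, -1, -1, -1, 1]"

definition knot_9_49 :: gauss_code where
  "knot_9_49 = signed_code
     [1, 2, -3, 4, -5, -1, 6, 7, -8, 3, -2, -6, 9, 5, -4, 8, -7, -9]
     [1, 1, 1, 1, 1, 1, 1, 1, 1]"

definition knot_10_157 :: gauss_code where
  "knot_10_157 = signed_code
     [1, -2, 3, 4, -5, 6, -7, 8, -9, -1, 2, -3, -6, 10, -8, 9, -4, 5, -10, 7]
     [1, 1, 1, 1, 1, -1, -1, 1, 1, 1]"


text \<open>
  To check that the five codes are codes of knot diagrams, the faces are listed; each of them is given
  by the position of a passage in the code, a direction and a number of edges.
\<close>

fun face_of :: "gauss_code \<Rightarrow> nat \<times> bool \<times> nat \<Rightarrow> (passage \<times> bool) list" where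
  "face_of w (i, d, n) = map (\<lambda>k. (face_step w ^^ k) (w ! i, d)) [0..<n]"

lemma distinct_map_set:
  assumes "distinct (concat xss)" "[] \<notin> set xss"
  shows "distinct (map set xss)"
  using assms
proof (induction xss)
  case (Cons xs xss)
  have "set xs \<notin> set ` set xss"
  proof
    assume "set xs \<in> set ` set xss"
    then have "set xs \<subseteq> set (concat xss)" by auto
    moreover have "set xs \<inter> set (concat xss) = {}" using Cons.prems by simp
    ultimately have "set xs = {}" by (metis Int_absorb2)
    with Cons.prems show False by simp
  qed
  with Cons show ?case by simp
qed simp

lemma knot_diagramI:
  assumes wf: "well_formed w"
    and fs: "(\<forall>(i, d, n) \<in> set fs. n > 0 \<and> (face_step w ^^ n) (w ! i, d) = (w ! i, d)) \<and>
      distinct (concat (map (face_of w) fs)) \<and>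
      set (concat (map (face_of w) fs)) = set w \<times> {True, False} \<and>
      length fs = length w div 2 + 2"
  shows "knot_diagram w"
proof -
  have per: "n > 0" "(face_step w ^^ n) (w ! i, d) = (w ! i, d)" if "(i, d, n) \<in> set fs" for i d n
    using fs that by blast+
  have disj: "distinct (concat (map (face_of w) fs))" using fs by blast
  have cover: "set (concat (map (face_of w) fs)) = set w \<times> {True, False}" using fs by blast
  have len: "length fs = length w div 2 + 2" using fs by blast
  have orb: "orbit (face_step w) x = set (face_of w p)"
    if "p \<in> set fs" "x \<in> set (face_of w p)" for p x
  proof -
    obtain i d n where p: "p = (i, d, n)" by (cases p)
    let ?f = "face_step w" and ?y = "(w ! i, d)"
    from that p per have n: "n > 0" "(?f ^^ n) ?y = ?y" by blast+
    have eq: "orbit ?f ?y = (\<lambda>k. (?f ^^ k) ?y) ` {..<n}"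
    proof (rule equalityI; rule subsetI)
      fix z assume "z \<in> orbit ?f ?y"
      then obtain k where "z = (?f ^^ k) ?y" by (auto simp: orbit_altdef)
      also have "\<dots> = (?f ^^ (k mod n)) ?y" using n(2) by (simp add: funpow_mod_eq)
      finally show "z \<in> (\<lambda>k. (?f ^^ k) ?y) ` {..<n}" using n(1) by auto
    next
      fix z assume "z \<in> (\<lambda>k. (?f ^^ k) ?y) ` {..<n}"
      then obtain k where "z = (?f ^^ k) ?y" by auto
      also have "\<dots> = (?f ^^ (k + n)) ?y" using n(2) by (simp add: funpow_add)
      finally show "z \<in> orbit ?f ?y" using n(1) by (auto simp: orbit_altdef)
    qed
    have y: "?y \<in> orbit ?f ?y" unfolding orbit_altdef using n by (auto intro!: exI[of _ n])
    have x: "x \<in> orbit ?f ?y" using that(2) by (auto simp: p eq)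
    have "orbit ?f x = orbit ?f ?y" by (rule orbit_cyclic_eq3) (use x y in \<open>auto simp: cyclic_on_def\<close>)
    then show ?thesis using eq by (auto simp: p)
  qed
  have ne: "face_of w p \<noteq> []" if "p \<in> set fs" for p
    using per that by (cases p) fastforce
  have "faces w = (\<lambda>p. set (face_of w p)) ` set fs"
  proof -
    have "faces w = orbit (face_step w) ` (\<Union>p \<in> set fs. set (face_of w p))"
      using cover by (simp add: faces_def UNIV_bool insert_commute)
    also have "\<dots> = (\<Union>p \<in> set fs. orbit (face_step w) ` set (face_of w p))"
      by (simp add: image_UN)
    also have "\<dots> = (\<Union>p \<in> set fs. {set (face_of w p)})"
    proof (intro SUP_cong refl)
      fix p assume p: "p \<in> set fs"
      have "set (face_of w p) \<noteq> {}" using ne[OF p] by simp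
      then show "orbit (face_step w) ` set (face_of w p) = {set (face_of w p)}"
        using orb[OF p] by (simp add: image_constant_conv cong: image_cong)
    qed
    finally show ?thesis by auto
  qed
  also have "card \<dots> = length fs"
  proof -
    have "[] \<notin> set (map (face_of w) fs)" using ne by fastforce
    with disj have "distinct (map set (map (face_of w) fs))" by (rule distinct_map_set)
    then have "distinct (map (\<lambda>p. set (face_of w p)) fs)" by (simp add: comp_def)
    from distinct_card[OF this] show ?thesis by simp
  qed
  finally have "card (faces w) = length fs" .
  with len have "planar w" by (simp add: planar_def)
  with wf show ?thesis by (simp add: knot_diagram_def)
qed

lemma knot_diagram_9_35: "knot_diagram knot_9_35"
  by (rule knot_diagramI[where fs = "
      [(0, True, 6), (0, False, 6), (1, True, 2), (1, False, 3), (2, False, 6),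
       (3, True, 3), (3, False, 2), (5, True, 2), (5, False, 2), (7, True, 2),
       (9, False, 2)]"])
    (code_simp, code_simp)

lemma knot_diagram_9_47: "knot_diagram knot_9_47"
  by (rule knot_diagramI[where fs = "
      [(0, True, 3), (0, False, 3), (1, True, 3), (1, False, 4), (2, True, 4),
       (2, False, 3), (3, True, 4), (3, False, 3), (4, False, 3), (5, True, 4),
       (10, True, 2)]"])
    (code_simp, code_simp)

lemma knot_diagram_9_48: "knot_diagram knot_9_48"
  by (rule knot_diagramI[where fs = "
      [(0, True, 5), (0, False, 4), (1, True, 5), (1, False, 3), (2, False, 2),
       (3, True, 3), (4, True, 5), (5, True, 2), (5, False, 2), (7, True, 3),
       (8, False, 2)]"])
    (code_simp, code_simp)

lemma knot_diagram_9_49: "knot_diagram knot_9_49"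
  by (rule knot_diagramI[where fs = "
      [(0, True, 3), (0, False, 3), (1, True, 5), (1, False, 5), (2, True, 3),
       (2, False, 2), (3, True, 5), (4, False, 2), (5, True, 3), (6, True, 3),
       (8, False, 2)]"])
    (code_simp, code_simp)

lemma knot_diagram_10_157: "knot_diagram knot_10_157"
  by (rule knot_diagramI[where fs = "
      [(0, True, 2), (0, False, 4), (1, True, 5), (1, False, 5), (2, True, 4),
       (2, False, 2), (3, True, 2), (4, False, 5), (5, False, 3), (6, False, 3),
       (7, True, 2), (7, False, 3)]"])
    (code_simp, code_simp)


section \<open>The colouring matrix\<close>

text \<open>
  The group ring of the integers is the ring of Laurent polynomials with integer coefficients.
\<close>

type_synonym laurent = "int \<Rightarrow>\<^sub>0 int"

definition m_pow :: "int \<Rightarrow> laurent" where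
  "m_pow e = Poly_Mapping.single e 1"

definition under_passages :: "gauss_code \<Rightarrow> passage list" where
  "under_passages w = filter (\<lambda>(c, l, s). l = Under) w"

text \<open>
  Let \<open>N\<close> be the number of crossings. The crossings are numbered from 0 to \<open>N - 1\<close> in the order in
  which the knot passes under them, and the arcs such that arc \<open>k\<close> is the incoming under-arc at
  crossing \<open>k\<close>. So the arc leaving crossing \<open>k\<close> is \<open>k + 1\<close> modulo \<open>N\<close>, and an upper passage lies
  on the arc whose number is the number of preceding lower passages, modulo \<open>N\<close>.
\<close>

definition over_arc :: "gauss_code \<Rightarrow> passage \<Rightarrow> nat" where
  "over_arc w x =
     length (under_passages (takeWhile (\<lambda>y. y \<noteq> x) w)) mod length (under_passages w)"

definition colouring_matrix :: "gauss_code \<Rightarrow> laurent mat" where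
  "colouring_matrix w =
     (let N = length (under_passages w) in
      mat N N (\<lambda>(k, j).
        let x = under_passages w ! k;
            t = m_pow (snd (snd x))
        in (if j = k then t else 0)
           + (if j = over_arc w (partner x) then 1 - t else 0)
           - (if j = Suc k mod N then 1 else 0)))"


section \<open>Equivalence of matrices\<close>

inductive matrix_move :: "laurent mat \<Rightarrow> laurent mat \<Rightarrow> bool" where
  "k < dim_row A \<Longrightarrow> a \<in> {m_pow 1, m_pow (-1), -1} \<Longrightarrow> matrix_move A (multrow k a A)"
| "k < dim_row A \<Longrightarrow> l < dim_row A \<Longrightarrow> k \<noteq> l \<Longrightarrow> matrix_move A (addrow 1 k l A)"
| "k < dim_row A \<Longrightarrow> l < dim_row A \<Longrightarrow> matrix_move A (swaprows k l A)"
| "k < dim_col A \<Longrightarrow> l < dim_col A \<Longrightarrow> matrix_move A (swapcols k l A)"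

definition matrix_equivalent :: "laurent mat \<Rightarrow> laurent mat \<Rightarrow> bool" where
  "matrix_equivalent A B \<longleftrightarrow> matrix_move\<^sup>*\<^sup>* A B"

definition triangularizable :: "laurent mat \<Rightarrow> bool" where
  "triangularizable A \<longleftrightarrow> (\<exists>B. matrix_equivalent A B \<and> upper_triangular B)"

end

theory Submission
  imports
    Defs
    "HOL-Computational_Algebra.Polynomial"
    "HOL-Number_Theory.Cong"
    "HOL-Library.Numeral_Type"
begin

text \<open>
  Let a ring \<open>R\<close> with a unit \<open>a\<close> be given. The solutions over \<open>R\<close> of the linear system of the colouring
  matrix at \<open>m = a\<close> are the colourings of the diagram by the Alexander quandle of \<open>R\<close>, and the
  existence of a colouring that is not constant modulo a given ideal does not depend on the diagram
  of the knot. Row operations and column swaps preserve it, too.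

  For the five knots there is a nonconstant colouring over the field with \<open>p\<close> elements at \<open>m = -1\<close>,
  where \<open>p\<close> is 3, 3, 3, 5, 7. So in an equivalent triangular matrix some diagonal entry other than
  the last one lies in the maximal ideal \<open>P = (p, m + 1)\<close>; let \<open>d\<close> be the first of these. In a local
  ring in which \<open>d\<close> vanishes and the residue of \<open>m\<close> is \<open>-1\<close>, the preceding diagonal entries are
  units, so back substitution gives a solution with two coordinates 1 and 0, which is not constant
  modulo the maximal ideal. If \<open>d'(-1)\<close> is divisible by \<open>p\<close>, then such a ring is \<open>F_p[s]/(s^2)\<close> with
  \<open>m = -1 + s\<close>; otherwise, by Hensel's lemma, it is the ring of integers modulo \<open>p^k\<close> with \<open>m\<close> an
  integer congruent to \<open>-1\<close> modulo \<open>p\<close>. But the Alexander module of each of the knots is presented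
  by a 2 by 2 matrix with entries in \<open>P\<close>, from which one reads off that no such colouring exists.
\<close>

section \<open>Colourings of Gauss codes\<close>

text \<open>The operation of the Alexander quandle: \<open>x\<close> is the colour of the lower
  strand before the crossing, \<open>y\<close> that of the upper strand, and the result is the
  colour of the lower strand behind it.\<close>

definition quandle_op :: "'r::comm_ring_1 \<Rightarrow> 'r \<Rightarrow> 'r \<Rightarrow> 'r" where
  "quandle_op t x y = t * x + (1 - t) * y"

text \<open>
  The elements \<open>a\<close> and \<open>a'\<close> stand for \<open>m\<close> and its inverse. The colour of the upper strand at the
  crossing \<open>c\<close> is \<open>h c\<close>; starting with the colour \<open>x\<close>, one can walk along the code and arrives with
  the colour \<open>y\<close>. A colouring of a diagram is a closed walk.
\<close>

fun runs :: "'r::comm_ring_1 \<Rightarrow> 'r \<Rightarrow> (nat \<Rightarrow> 'r) \<Rightarrow> 'r \<Rightarrow> gauss_code \<Rightarrow> 'r \<Rightarrow> bool" where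
  "runs a a' h x [] y \<longleftrightarrow> x = y"
| "runs a a' h x ((c, Over, s) # w) y \<longleftrightarrow> h c = x \<and> runs a a' h x w y"
| "runs a a' h x ((c, Under, s) # w) y \<longleftrightarrow>
     runs a a' h (quandle_op (if s = 1 then a else a') x (h c)) w y"

abbreviation labels :: "gauss_code \<Rightarrow> nat set" where
  "labels w \<equiv> fst ` set w"

text \<open>Congruence modulo the annihilator of \<open>e\<close>.\<close>

definition constant_mod :: "'r::comm_ring_1 \<Rightarrow> (nat \<Rightarrow> 'r) \<Rightarrow> 'r \<Rightarrow> gauss_code \<Rightarrow> bool" where
  "constant_mod e h q w \<longleftrightarrow> (\<forall>c \<in> labels w. e * h c = e * q)"

text \<open>Multiplication by \<open>e\<close> stands in for reduction to the residue field: in the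
  dual numbers over a field the annihilator of \<open>s\<close> is the maximal ideal, and so is that
  of \<open>p^(k-1)\<close> in the integers modulo \<open>p^k\<close>.\<close>

definition nontrivially_colourable :: "'r::comm_ring_1 \<Rightarrow> 'r \<Rightarrow> 'r \<Rightarrow> gauss_code \<Rightarrow> bool" where
  "nontrivially_colourable a a' e w \<longleftrightarrow> (\<exists>h q. runs a a' h q w q \<and> \<not> constant_mod e h q w)"

lemma opposite_neq [simp]: "opposite l \<noteq> l" "l \<noteq> opposite l"
  by (cases l; simp)+

lemma runs_append: "runs a a' h x (u @ v) y \<longleftrightarrow> (\<exists>z. runs a a' h x u z \<and> runs a a' h z v y)"
  by (induction a a' h x u y rule: runs.induct) auto

lemma runs_cong:
  assumes "\<And>c. c \<in> labels w \<Longrightarrow> h c = h' c"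
  shows "runs a a' h x w y \<longleftrightarrow> runs a a' h' x w y"
  using assms by (induction a a' h x w y rule: runs.induct) auto

lemma runs_upd: "c \<notin> labels w \<Longrightarrow> runs a a' (h(c := z)) x w y \<longleftrightarrow> runs a a' h x w y"
  by (rule runs_cong) auto

lemma runs_relabel:
  "runs a a' h x (map (\<lambda>(c, l, s). (f c, l, s)) w) y \<longleftrightarrow> runs a a' (h \<circ> f) x w y"
  by (induction a a' "h \<circ> f" x w y rule: runs.induct) auto

lemma quandle_op_idem [simp]: "quandle_op t x x = x"
  by (simp add: quandle_op_def algebra_simps)

lemma quandle_op_cancel:
  assumes "t * t' = 1"
  shows "quandle_op t (quandle_op t' x y) y = x"
proof -
  have "quandle_op t (quandle_op t' x y) y = (t * t') * x + (1 - t * t') * y"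
    by (simp add: quandle_op_def algebra_simps)
  then show ?thesis using assms by simp
qed

text \<open>Self-distributivity with two independent parameters, so that the third Reidemeister move
  can be treated for all signs at once.\<close>

lemma quandle_op_distrib:
  "quandle_op t (quandle_op r x y) z = quandle_op r (quandle_op t x z) (quandle_op t y z)"
  by (simp add: quandle_op_def algebra_simps)

lemma quandle_op_constant:
  assumes "e * x = e * q" "e * y = e * q"
  shows "e * quandle_op t x y = e * q"
proof -
  have "e * quandle_op t x y = t * (e * x) + (1 - t) * (e * y)"
    by (simp add: quandle_op_def algebra_simps)
  then show ?thesis by (simp add: assms algebra_simps)
qed

text \<open>Modulo the annihilator of \<open>e\<close>, each lower passage combines two equal
  colours and leaves the colour alone. This lets constancy be tested against the colour at any point
  of the walk.\<close>

lemma runs_constant: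
  assumes "runs a a' h x w y" "constant_mod e h q w" "e * x = e * q"
  shows "e * y = e * q"
  using assms unfolding constant_mod_def
  by (induction a a' h x w y rule: runs.induct) (auto simp: quandle_op_constant)

lemma constant_mod_append [simp]:
  "constant_mod e h q (u @ v) \<longleftrightarrow> constant_mod e h q u \<and> constant_mod e h q v"
  by (auto simp: constant_mod_def)

lemma constant_mod_upd:
  "c \<notin> labels w \<Longrightarrow> constant_mod e (h(c := z)) q w \<longleftrightarrow> constant_mod e h q w"
  by (auto simp: constant_mod_def)

lemma constant_mod_base:
  "e * q = e * q' \<Longrightarrow> constant_mod e h q w \<longleftrightarrow> constant_mod e h q' w"
  by (auto simp: constant_mod_def)

lemma constant_mod_simps [simp]:
  "constant_mod e h q []"
  "constant_mod e h q (x # w) \<longleftrightarrow> e * h (fst x) = e * q \<and> constant_mod e h q w"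
  by (auto simp: constant_mod_def)


section \<open>Invariance under Reidemeister moves\<close>

lemma well_formed_sign: "well_formed w \<Longrightarrow> (c, l, s) \<in> set w \<Longrightarrow> s = 1 \<or> s = -1"
  by (auto simp: well_formed_def)

section \<open>Crossing labels in well-formed codes\<close>

lemma well_formed_partner: "well_formed w \<Longrightarrow> (c, l, s) \<in> set w \<Longrightarrow> (c, opposite l, s) \<in> set w"
  by (auto simp: well_formed_def)

lemma well_formed_same_sign:
  fixes s s' :: int
  assumes "well_formed w" "(c, l, s) \<in> set w" "(c, l', s') \<in> set w"
  shows "s' = s"
proof (rule ccontr)
  assume "s' \<noteq> s"
  moreover have "s = 1 \<or> s = -1" "s' = 1 \<or> s' = -1"
    using well_formed_sign[OF assms(1)] assms(2,3) by blast+
  ultimately have "s' = -s" by auto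
  moreover have "(c, l, -s) \<notin> set w" using assms(1,2) by (auto simp: well_formed_def)
  moreover have "l' = l \<or> l' = opposite l" by (cases l; cases l') auto
  ultimately show False
    using assms(3) well_formed_partner[OF assms(1,3)] by (cases l) auto
qed

lemma well_formed_label:
  assumes "well_formed w" "(c, l, s) \<in> set w" "(c, l', s') \<in> set w"
  shows "(c, l', s') = (c, l, s) \<or> (c, l', s') = (c, opposite l, s)"
  using well_formed_same_sign[OF assms] by (cases l; cases l') auto

text \<open>A label occurs only in its two passages, and both already lie in \<open>r\<close>. This
  freshness allows the colour at a crossing that is created or changed by a move to be chosen
  freely.\<close>

lemma label_not_in_rest:
  assumes "well_formed w" "mset w = mset r + mset u" "(c, l, s) \<in> set r" "(c, opposite l, s) \<in> set r"
  shows "c \<notin> labels u"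
proof
  assume "c \<in> labels u"
  then obtain l' s' where u: "(c, l', s') \<in> set u" by auto
  have set: "set w = set r \<union> set u" using assms(2) by (metis set_mset_mset set_mset_union)
  have "distinct w" using assms(1) by (simp add: well_formed_def)
  then have "distinct (r @ u)"
    using assms(2) by (metis mset_append mset_eq_imp_distinct_iff)
  moreover have "(c, l', s') \<in> set r"
    using well_formed_label[OF assms(1), of c l s l' s'] assms(3,4) u set by auto
  ultimately show False using u by auto
qed

text \<open>Formulated for single colourings and with constancy passed backwards, because a move may
  change both the base colour and the colour at a crossing.\<close>

definition colourings_transfer :: "'r::comm_ring_1 \<Rightarrow> 'r \<Rightarrow> 'r \<Rightarrow> gauss_code \<Rightarrow> gauss_code \<Rightarrow> bool" where
  "colourings_transfer a a' e w w' \<longleftrightarrow> (\<forall>h q. runs a a' h q w q \<longrightarrow>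
     (\<exists>h' q'. runs a a' h' q' w' q' \<and> (constant_mod e h' q' w' \<longrightarrow> constant_mod e h q w)))"

lemma colourings_transferD:
  "colourings_transfer a a' e w w' \<Longrightarrow> nontrivially_colourable a a' e w \<Longrightarrow>
   nontrivially_colourable a a' e w'"
  unfolding colourings_transfer_def nontrivially_colourable_def by blast

text \<open>The colour reached between \<open>u\<close> and \<open>v\<close> becomes the new base
  colour.\<close>

lemma transfer_rotate: "colourings_transfer a a' e (u @ v) (v @ u)"
  unfolding colourings_transfer_def
proof (intro allI impI)
  fix h q assume "runs a a' h q (u @ v) q"
  then obtain z where z: "runs a a' h q u z" "runs a a' h z v q" by (auto simp: runs_append)
  have "constant_mod e h q (u @ v)" if "constant_mod e h z (v @ u)"
  proof -
    have "e * q = e * z" using runs_constant[OF z(2)] that by auto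
    then show ?thesis using that constant_mod_base by (metis constant_mod_append)
  qed
  with z show "\<exists>h' q'. runs a a' h' q' (v @ u) q' \<and>
      (constant_mod e h' q' (v @ u) \<longrightarrow> constant_mod e h q (u @ v))"
    by (auto simp: runs_append)
qed

lemma transfer_relabel:
  fixes w :: gauss_code
  assumes "inj_on f (labels w)"
  defines "w' \<equiv> map (\<lambda>(c, l, s). (f c, l, s)) w"
  shows "colourings_transfer a a' e w w'" "colourings_transfer a a' e w' w"
proof -
  have lab: "labels w' = f ` labels w" unfolding w'_def by force
  have const: "constant_mod e h q w' \<longleftrightarrow> constant_mod e (h \<circ> f) q w" for h q
    unfolding constant_mod_def lab by auto
  show "colourings_transfer a a' e w' w"
    unfolding colourings_transfer_def const unfolding w'_def runs_relabel by blast
  show "colourings_transfer a a' e w w'"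
    unfolding colourings_transfer_def
  proof (intro allI impI)
    fix h q assume r: "runs a a' h q w q"
    define h' where "h' = h \<circ> the_inv_into (labels w) f"
    have eq: "h c = (h' \<circ> f) c" if "c \<in> labels w" for c
      using that assms(1) by (simp add: h'_def the_inv_into_f_f)
    have "runs a a' h' q w' q"
      unfolding w'_def runs_relabel by (rule iffD1[OF runs_cong r]) (rule eq)
    moreover have "constant_mod e h' q w' \<longrightarrow> constant_mod e h q w"
      unfolding const unfolding constant_mod_def using eq by auto
    ultimately show "\<exists>h' q'. runs a a' h' q' w' q' \<and>
        (constant_mod e h' q' w' \<longrightarrow> constant_mod e h q w)" by blast
  qed
qed

lemma mset_three_eq:
  assumes "mset [x, y, z] = mset [u, v, w]"
  shows "(x, y, z) \<in> {(u, v, w), (u, w, v), (v, u, w), (v, w, u), (w, u, v), (w, v, u)}"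
proof -
  have two: "(y = v \<and> z = w) \<or> (y = w \<and> z = v)" if "{#y, z#} = {#v, w#}" for y z v w :: 'a
    using that by (auto simp: add_eq_conv_diff)
  have "x \<in># {#u, v, w#}" using assms by (metis mset.simps union_single_eq_member mset_single_iff_right add_mset_add_single list.set_intros(1) set_mset_mset)
  then consider "x = u" | "x = v" | "x = w" by auto
  then show ?thesis
  proof cases
    case 1 with assms two[of y z v w] show ?thesis by auto
  next
    case 2 with assms two[of y z u w] show ?thesis by (auto simp: add_mset_commute)
  next
    case 3 with assms two[of y z u v] show ?thesis by (auto simp: add_mset_commute)
  qed
qed

context
  fixes a a' :: "'r::comm_ring_1"
  assumes inv: "a * a' = 1"
begin

lemma inv_sym: "a' * a = 1"
  using inv by (simp add: mult.commute)

lemma quandle_op_back: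
  fixes s :: int
  assumes "s = 1 \<or> s = -1"
  shows "quandle_op (if -s = 1 then a else a') (quandle_op (if s = 1 then a else a') x y) y = x"
  using assms inv inv_sym quandle_op_cancel by auto

text \<open>The crossing is undone with the inverse parameter. This handles a kink that is entered
  on its lower strand.\<close>

lemma quandle_op_eq_right:
  assumes "y = quandle_op (if b then a else a') x y"
  shows "x = y"
proof -
  have "quandle_op (if b then a' else a) (quandle_op (if b then a else a') x y) y = x"
    using quandle_op_cancel inv inv_sym by auto
  then show ?thesis by (simp flip: assms)
qed

lemma transfer_R1:
  assumes wf: "well_formed ([(c, l, s), (c, opposite l, s)] @ u)"
  shows "colourings_transfer a a' e ([(c, l, s), (c, opposite l, s)] @ u) u"
    and "colourings_transfer a a' e u ([(c, l, s), (c, opposite l, s)] @ u)"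
proof -
  let ?w = "[(c, l, s), (c, opposite l, s)]"
  have fresh: "c \<notin> labels u" by (rule label_not_in_rest[OF wf, of ?w]) auto
  have loop: "runs a a' h x ?w y \<longleftrightarrow> h c = x \<and> y = x" for h x y
    using quandle_op_eq_right[of "h c" "s = 1" x] by (cases l) auto
  show "colourings_transfer a a' e (?w @ u) u"
    unfolding colourings_transfer_def runs_append loop by auto
  show "colourings_transfer a a' e u (?w @ u)"
    unfolding colourings_transfer_def
  proof (intro allI impI)
    fix h q assume "runs a a' h q u q"
    then have "runs a a' (h(c := q)) q (?w @ u) q"
      unfolding runs_append loop runs_upd[OF fresh] by simp
    moreover have "constant_mod e (h(c := q)) q (?w @ u) \<longrightarrow> constant_mod e h q u"
      by (simp add: constant_mod_upd[OF fresh])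
    ultimately show "\<exists>h' q'. runs a a' h' q' (?w @ u) q' \<and>
        (constant_mod e h' q' (?w @ u) \<longrightarrow> constant_mod e h q u)" by blast
  qed
qed

lemma transfer_R2:
  assumes Q: "Q = [(k, opposite l, s), (n, opposite l, -s)] \<or> Q = [(n, opposite l, -s), (k, opposite l, s)]"
    and wf: "well_formed ([(k, l, s), (n, l, -s)] @ u @ Q @ v)"
  shows "colourings_transfer a a' e ([(k, l, s), (n, l, -s)] @ u @ Q @ v) (u @ v)"
    and "colourings_transfer a a' e (u @ v) ([(k, l, s), (n, l, -s)] @ u @ Q @ v)"
proof -
  let ?P = "[(k, l, s), (n, l, -s)]"
  have s: "s = 1 \<or> s = -1" by (rule well_formed_sign[OF wf, of k l]) auto
  have "k \<notin> labels (u @ v)"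
    by (rule label_not_in_rest[OF wf, of "?P @ Q" _ k l s]) (use Q in auto)
  moreover have "n \<notin> labels (u @ v)"
    by (rule label_not_in_rest[OF wf, of "?P @ Q" _ n l "-s"]) (use Q in auto)
  ultimately have fresh: "k \<notin> labels u" "k \<notin> labels v" "n \<notin> labels u" "n \<notin> labels v"
    by (simp_all add: image_Un)
  have kn: "k \<noteq> n"
    using well_formed_same_sign[OF wf, of k l s l "-s"] s by auto
  \<comment> \<open>Both crossings lie on the same upper strand, hence have the same upper colour;
    their opposite signs then make the two lower passages cancel. Here \<open>x\<close> and
    \<open>x'\<close> are the colours with which the two strands are entered.\<close>
  have strands: "runs a a' h x ?P y \<and> runs a a' h x' Q y' \<longleftrightarrow>
      y = x \<and> y' = x' \<and> h k = (if l = Over then x else x') \<and> h n = (if l = Over then x else x')"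
    for h x y x' y'
  proof -
    have cancel: "quandle_op a (quandle_op a' x y) y = x" "quandle_op a' (quandle_op a x y) y = x" for x y
      using quandle_op_cancel inv inv_sym by blast+
    show ?thesis
      using Q s by (cases l; elim disjE; cases "h n = h k"; simp add: cancel; metis)
  qed
  have runs: "runs a a' h q (?P @ u @ Q @ v) q \<longleftrightarrow> (\<exists>z. runs a a' h q u z \<and> runs a a' h z v q \<and>
      h k = (if l = Over then q else z) \<and> h n = (if l = Over then q else z))" for h q
  proof
    assume "runs a a' h q (?P @ u @ Q @ v) q"
    then obtain q1 z z1 where r: "runs a a' h q ?P q1" "runs a a' h q1 u z" "runs a a' h z Q z1"
      "runs a a' h z1 v q"
      unfolding runs_append by (elim exE conjE)
    have eq: "q1 = q" "z1 = z" and "h k = (if l = Over then q else z)" "h n = (if l = Over then q else z)"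
      using iffD1[OF strands conjI[OF r(1,3)]] by - (elim conjE, assumption)+
    with r(2,4) show "\<exists>z. runs a a' h q u z \<and> runs a a' h z v q \<and>
      h k = (if l = Over then q else z) \<and> h n = (if l = Over then q else z)"
      unfolding eq by (intro exI[of _ z] conjI)
  next
    assume "\<exists>z. runs a a' h q u z \<and> runs a a' h z v q \<and>
      h k = (if l = Over then q else z) \<and> h n = (if l = Over then q else z)"
    then obtain z where z: "runs a a' h q u z" "runs a a' h z v q"
      "h k = (if l = Over then q else z)" "h n = (if l = Over then q else z)" by (elim exE conjE)
    have PQ: "runs a a' h q ?P q \<and> runs a a' h z Q z"
      by (rule iffD2[OF strands]) (intro conjI refl z(3,4))
    show "runs a a' h q (?P @ u @ Q @ v) q"
      unfolding runs_append
      by (intro exI[of _ q] exI[of _ z] conjI conjunct1[OF PQ] conjunct2[OF PQ] z(1,2))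
  qed
  show "colourings_transfer a a' e (?P @ u @ Q @ v) (u @ v)"
    unfolding colourings_transfer_def
  proof (intro allI impI)
    fix h q assume "runs a a' h q (?P @ u @ Q @ v) q"
    then obtain z where z: "runs a a' h q u z" "runs a a' h z v q"
      "h k = (if l = Over then q else z)" "h n = (if l = Over then q else z)"
      unfolding runs by (elim exE conjE)
    have "constant_mod e h q (?P @ u @ Q @ v)" if "constant_mod e h q (u @ v)"
      using runs_constant[OF z(1)] that z(3,4) Q by auto
    moreover have "runs a a' h q (u @ v) q"
      unfolding runs_append using z(1,2) by blast
    ultimately show "\<exists>h' q'. runs a a' h' q' (u @ v) q' \<and>
        (constant_mod e h' q' (u @ v) \<longrightarrow> constant_mod e h q (?P @ u @ Q @ v))" by blast
  qed
  show "colourings_transfer a a' e (u @ v) (?P @ u @ Q @ v)"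
    unfolding colourings_transfer_def
  proof (intro allI impI)
    fix h q assume "runs a a' h q (u @ v) q"
    then obtain z where z: "runs a a' h q u z" "runs a a' h z v q"
      by (auto simp: runs_append)
    define h' where "h' = h(k := if l = Over then q else z, n := if l = Over then q else z)"
    have "runs a a' h' q (?P @ u @ Q @ v) q"
      unfolding runs using z kn by (intro exI[of _ z]) (simp add: h'_def runs_upd fresh)
    moreover have "constant_mod e h' q (?P @ u @ Q @ v) \<longrightarrow> constant_mod e h q (u @ v)"
      by (simp add: h'_def constant_mod_upd fresh)
    ultimately show "\<exists>h' q'. runs a a' h' q' (?P @ u @ Q @ v) q' \<and>
        (constant_mod e h' q' (?P @ u @ Q @ v) \<longrightarrow> constant_mod e h q (u @ v))" by blast
  qed
qed

text \<open>Only the colour of the middle strand at its crossing with the bottom strand changes: it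
  is read before instead of after the passage under the top strand, or vice versa.
  Self-distributivity keeps the colour at the far end of the bottom strand.\<close>

lemma runs_triangle_side:
  assumes T: "T = in_order (k * eb) (c1, Over, ea) (c2, Over, eb)"
    and M: "M = in_order (k * ec) (c1, Under, ea) (c3, Over, ec)"
    and B: "B = in_order (k * ea * eb * ec) (c2, Under, eb) (c3, Under, ec)"
    and signs: "{ea, eb, ec, k} \<subseteq> {1, -1}"
    and c3: "c3 \<noteq> c1" "c3 \<noteq> c2"
    and runs: "runs a a' h x1 T y1" "runs a a' h x2 M y2" "runs a a' h x3 B y3"
  defines "h' \<equiv> h(c3 := if k * ec = 1 then x2 else y2)"
  shows "runs a a' h' x1 (rev T) y1" "runs a a' h' x2 (rev M) y2" "runs a a' h' x3 (rev B) y3"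
proof -
  let ?op = "\<lambda>s::int. quandle_op (if s = 1 then a else a')"
  have sg: "ea = 1 \<or> ea = -1" "eb = 1 \<or> eb = -1" "ec = 1 \<or> ec = -1" "k = 1 \<or> k = -1"
    using signs by auto
  have kec: "k * ec = 1 \<or> k * ec = -1" and eab: "eb = ea \<or> eb = -ea"
    and ee: "ea * ea = 1" using sg by auto
  have T': "h c1 = x1" "h c2 = x1" "y1 = x1"
    using runs(1) by (simp_all add: T in_order_def split: if_splits)
  then show "runs a a' h' x1 (rev T) y1"
    using c3 by (simp add: T in_order_def h'_def)
  have M': "?op ea x2 x1 = y2" "h c3 = (if k * ec = 1 then y2 else x2)"
    using runs(2) kec T' by (elim disjE; simp add: M in_order_def)+
  then show "runs a a' h' x2 (rev M) y2"
    using c3 kec T' by (elim disjE; simp add: M in_order_def h'_def)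
  have undo: "?op (- ea) y2 x1 = x2"
    using quandle_op_back[OF sg(1), of x2 x1] by (simp only: M'(1))
  have prod: "k * ea * eb * ec = (k * ec) * (ea * eb)" by (simp add: mult_ac)
  \<comment> \<open>Of the old and the new colour at \<open>c3\<close>, one arises from the other by
    passing under the top strand. Expressed with the sign \<open>eb\<close> seen by the bottom
    strand, the direction depends on the order of the crossings along that strand.\<close>
  have B': "if k * ea * eb * ec = 1 then ?op eb (h' c3) x1 = h c3 else ?op eb (h c3) x1 = h' c3"
    unfolding prod using kec eab
    by (elim disjE) (simp_all only: M'(2) h'_def fun_upd_same, simp_all add: ee M'(1) undo[simplified])
  show "runs a a' h' x3 (rev B) y3"
  proof (cases "k * ea * eb * ec = 1")
    case True
    then have "y3 = ?op ec (?op eb x3 x1) (h c3)"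
      using runs(3) T' by (auto simp: B in_order_def)
    also have "\<dots> = ?op eb (?op ec x3 (h' c3)) x1"
      using B' True by (simp only: quandle_op_distrib[of "if eb = 1 then a else a'"] if_True)
    finally show ?thesis using True T' c3 by (auto simp: B in_order_def h'_def)
  next
    case False
    then have neg: "\<not> k * ea * eb * ec > 0" using sg by auto
    have "y3 = ?op eb (?op ec x3 (h c3)) x1"
      using runs(3) T' neg by (auto simp: B in_order_def)
    also have "\<dots> = ?op ec (?op eb x3 x1) (h' c3)"
      using B' False by (simp only: quandle_op_distrib[of "if eb = 1 then a else a'"] if_False)
    finally show ?thesis using neg T' c3 by (auto simp: B in_order_def h'_def)
  qed
qed

lemma transfer_R3:
  assumes tri: "triangle T M B" and perm: "mset [P, Q, R] = mset [T, M, B]"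
    and wf: "well_formed (P @ u @ Q @ v @ R @ z)"
  shows "colourings_transfer a a' e (P @ u @ Q @ v @ R @ z) (rev P @ u @ rev Q @ v @ rev R @ z)"
  unfolding colourings_transfer_def
proof (intro allI impI)
  let ?w = "P @ u @ Q @ v @ R @ z" and ?w' = "rev P @ u @ rev Q @ v @ rev R @ z"
  fix h q assume "runs a a' h q ?w q"
  then obtain q1 q2 q3 q4 q5 where r: "runs a a' h q P q1" "runs a a' h q1 u q2"
    "runs a a' h q2 Q q3" "runs a a' h q3 v q4" "runs a a' h q4 R q5" "runs a a' h q5 z q"
    unfolding runs_append by blast
  obtain c1 c2 c3 ea eb ec k where signs: "{ea, eb, ec, k} \<subseteq> {1, -1}"
    and T: "T = in_order (k * eb) (c1, Over, ea) (c2, Over, eb)"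
    and M: "M = in_order (k * ec) (c1, Under, ea) (c3, Over, ec)"
    and B: "B = in_order (k * ea * eb * ec) (c2, Under, eb) (c3, Under, ec)"
    using tri unfolding triangle_def by blast
  have perms: "(P, Q, R) \<in> {(T, M, B), (T, B, M), (M, T, B), (M, B, T), (B, T, M), (B, M, T)}"
    using mset_three_eq[OF perm] .
  have mset: "mset ?w = mset (T @ M @ B) + mset (u @ v @ z)"
    using perms by auto
  have inM: "(c1, Under, ea) \<in> set M" "(c3, Over, ec) \<in> set M"
    and inB: "(c2, Under, eb) \<in> set B" "(c3, Under, ec) \<in> set B"
    and inT: "(c1, Over, ea) \<in> set T" "(c2, Over, eb) \<in> set T"
    by (auto simp: T M B in_order_def)
  have fresh: "c3 \<notin> labels (u @ v @ z)"
    by (rule label_not_in_rest[OF wf mset, of c3 Over ec]) (use inM inB in auto)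
  have "distinct ?w" using wf by (simp add: well_formed_def)
  then have dist: "distinct (T @ M @ B)"
    using perms by auto
  have sub: "set (T @ M @ B) \<subseteq> set ?w" using perms by auto
  have "c3 \<noteq> c1"
  proof
    assume "c3 = c1"
    then have "ea = ec" using well_formed_same_sign[OF wf, of c3 Over ec Over ea] sub inM inT by auto
    with \<open>c3 = c1\<close> show False using inM inT dist by auto
  qed
  moreover have "c3 \<noteq> c2"
  proof
    assume "c3 = c2"
    then have "eb = ec" using well_formed_same_sign[OF wf, of c3 Over ec Over eb] sub inM inT by auto
    with \<open>c3 = c2\<close> show False using inM inT dist by auto
  qed
  ultimately have c3: "c3 \<noteq> c1" "c3 \<noteq> c2" .
  note side = runs_triangle_side[OF T M B signs c3]
  \<comment> \<open>The colours at the two ends of the middle strand are named first, so that one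
    description of the new colouring serves for all six orders of the strands.\<close>
  have "\<exists>xM yM. runs a a' h xM M yM \<and> (let h' = h(c3 := if k * ec = 1 then xM else yM) in
      runs a a' h' q (rev P) q1 \<and> runs a a' h' q2 (rev Q) q3 \<and> runs a a' h' q4 (rev R) q5)"
    using perms
  proof (elim insertE emptyE)
    assume "(P, Q, R) = (T, M, B)" then show ?thesis using r side[of h q q1 q2 q3 q4 q5]
      by (intro exI[of _ q2] exI[of _ q3]) (auto simp: Let_def)
  next
    assume "(P, Q, R) = (T, B, M)" then show ?thesis using r side[of h q q1 q4 q5 q2 q3]
      by (intro exI[of _ q4] exI[of _ q5]) (auto simp: Let_def)
  next
    assume "(P, Q, R) = (M, T, B)" then show ?thesis using r side[of h q2 q3 q q1 q4 q5]
      by (intro exI[of _ q] exI[of _ q1]) (auto simp: Let_def)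
  next
    assume "(P, Q, R) = (M, B, T)" then show ?thesis using r side[of h q4 q5 q q1 q2 q3]
      by (intro exI[of _ q] exI[of _ q1]) (auto simp: Let_def)
  next
    assume "(P, Q, R) = (B, T, M)" then show ?thesis using r side[of h q2 q3 q4 q5 q q1]
      by (intro exI[of _ q4] exI[of _ q5]) (auto simp: Let_def)
  next
    assume "(P, Q, R) = (B, M, T)" then show ?thesis using r side[of h q4 q5 q2 q3 q q1]
      by (intro exI[of _ q2] exI[of _ q3]) (auto simp: Let_def)
  qed
  then obtain h' y where h': "h' = h(c3 := y)" "runs a a' h' q (rev P) q1"
    "runs a a' h' q2 (rev Q) q3" "runs a a' h' q4 (rev R) q5"
    unfolding Let_def by blast
  have "c3 \<notin> labels u" "c3 \<notin> labels v" "c3 \<notin> labels z" using fresh by auto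
  then have uvz: "runs a a' h' q1 u q2" "runs a a' h' q3 v q4" "runs a a' h' q5 z q"
    using r by (simp_all only: h'(1) runs_upd not_False_eq_True)
  have "constant_mod e h q ?w" if const: "constant_mod e h' q ?w'"
  proof -
    have qs: "e * q1 = e * q" "e * q2 = e * q" "e * q3 = e * q" "e * q4 = e * q" "e * q5 = e * q"
      using runs_constant[OF h'(2)] runs_constant[OF uvz(1)] runs_constant[OF h'(3)]
        runs_constant[OF uvz(2)] runs_constant[OF h'(4)] const by auto
    have old: "e * h c = e * q" if "c \<in> labels ?w" "c \<noteq> c3" for c
    proof -
      have "labels ?w' = labels ?w" by simp
      then have "e * h' c = e * q" using const that(1) unfolding constant_mod_def by blast
      then show ?thesis using that(2) by (simp add: h'(1))
    qed
    obtain xM yM where xy: "runs a a' h xM M yM" "e * xM = e * q" "e * yM = e * q"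
    proof -
      from perms consider "P = M" | "Q = M" | "R = M" by blast
      then show thesis
      proof cases
        case 1 then show thesis using that[OF r(1)[unfolded 1]] qs by blast
      next
        case 2 then show thesis using that[OF r(3)[unfolded 2]] qs by blast
      next
        case 3 then show thesis using that[OF r(5)[unfolded 3]] qs by blast
      qed
    qed
    \<comment> \<open>The old colour at \<open>c3\<close> occurs at an end of the middle strand. The
      end colours survive the move, so constancy is recovered at the one label whose colour
      changed.\<close>
    have "h c3 = xM \<or> h c3 = yM"
      using xy(1) by (auto simp: M in_order_def split: if_splits)
    then have "e * h c3 = e * q" using xy(2,3) by auto
    with old show ?thesis unfolding constant_mod_def by blast
  qed
  then show "\<exists>h' q'. runs a a' h' q' ?w' q' \<and> (constant_mod e h' q' ?w' \<longrightarrow> constant_mod e h q ?w)"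
    using h' uvz unfolding runs_append by blast
qed

lemma rev_in_order: "k \<noteq> 0 \<Longrightarrow> rev (in_order k x y) = in_order (- k) x y"
  by (auto simp: in_order_def)

text \<open>Replacing \<open>k\<close> by \<open>-k\<close> reverses all three orders. Hence the
  inverse of a third move is again a third move, and one direction of the transfer suffices.\<close>

lemma triangle_rev:
  assumes "triangle T M B"
  shows "triangle (rev T) (rev M) (rev B)"
proof -
  obtain c1 c2 c3 ea eb ec k where signs: "{ea, eb, ec, k} \<subseteq> {1, -1}"
    and TMB: "T = in_order (k * eb) (c1, Over, ea) (c2, Over, eb)"
      "M = in_order (k * ec) (c1, Under, ea) (c3, Over, ec)"
      "B = in_order (k * ea * eb * ec) (c2, Under, eb) (c3, Under, ec)"
    using assms unfolding triangle_def by blast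
  have nz: "k * eb \<noteq> 0" "k * ec \<noteq> 0" "k * ea * eb * ec \<noteq> 0" using signs by auto
  have "{ea, eb, ec, -k} \<subseteq> {1, -1}" using signs by auto
  moreover have "rev T = in_order (-k * eb) (c1, Over, ea) (c2, Over, eb)"
    "rev M = in_order (-k * ec) (c1, Under, ea) (c3, Over, ec)"
    "rev B = in_order (-k * ea * eb * ec) (c2, Under, eb) (c3, Under, ec)"
    unfolding TMB using nz by (simp_all add: rev_in_order)
  ultimately show ?thesis unfolding triangle_def by blast
qed

lemma reidemeister_transfer:
  assumes "reidemeister w w'" "well_formed w" "well_formed w'"
  shows "colourings_transfer a a' e w w' \<and> colourings_transfer a a' e w' w"
  using assms
proof (induction rule: reidemeister.induct)
  case (rotate u v)
  show ?case by (intro conjI transfer_rotate)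
next
  case (relabel f w)
  show ?case by (intro conjI transfer_relabel[OF relabel.hyps])
next
  case (R1 c l s u)
  show ?case by (intro conjI transfer_R1[OF R1.prems(1)])
next
  case (R2 Q k l s n u v)
  show ?case by (intro conjI transfer_R2[OF R2.hyps R2.prems(1)])
next
  case (R3 T M B P Q R u v z)
  have "mset [rev P, rev Q, rev R] = image_mset rev (mset [P, Q, R])" by simp
  also have "\<dots> = mset [rev T, rev M, rev B]" unfolding R3.hyps(2) by simp
  finally have "mset [rev P, rev Q, rev R] = mset [rev T, rev M, rev B]" .
  from transfer_R3[OF R3.hyps R3.prems(1)]
    transfer_R3[OF triangle_rev[OF R3.hyps(1)] this R3.prems(2)]
  show ?case by (simp only: rev_rev_ident simp_thms)
qed

lemma knot_equiv_colourable:
  assumes "knot_equiv D D'"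
  shows "nontrivially_colourable a a' e D \<longleftrightarrow> nontrivially_colourable a a' e D'"
  using assms unfolding knot_equiv_def
proof (induction rule: rtranclp_induct)
  case (step y z)
  then have "colourings_transfer a a' e y z \<and> colourings_transfer a a' e z y"
    using reidemeister_transfer unfolding knot_diagram_def by blast
  with step.IH show ?case using colourings_transferD by blast
qed simp

end

section \<open>Reversal and mirror image\<close>

lemma runs_rev:
  fixes a a' :: "'r::comm_ring_1"
  assumes "a * a' = 1"
  shows "runs a a' h x (rev w) y \<longleftrightarrow> runs a' a h y w x"
proof -
  have cancel: "quandle_op a (quandle_op a' x y) y = x" "quandle_op a' (quandle_op a x y) y = x" for x y
    using quandle_op_cancel assms by (metis mult.commute)+
  \<comment> \<open>Going back through a lower passage applies the inverse operation, which
    exchanges \<open>a\<close> and \<open>a'\<close>.\<close>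
  have swap: "quandle_op (if b then a else a') x z = y \<longleftrightarrow> quandle_op (if b then a' else a) y z = x"
    for b x y z using cancel by auto
  show ?thesis
  proof (induction w arbitrary: y)
    case (Cons p w)
    obtain c l s where p: "p = (c, l, s)" by (cases p)
    show ?case using Cons.IH swap by (cases l) (auto simp: p runs_append)
  qed auto
qed

lemma runs_mirror:
  assumes "\<forall>(c, l, s) \<in> set w. s = 1 \<or> s = -1"
  shows "runs a a' h x (mirror w) y \<longleftrightarrow> runs a' a h x w y"
  using assms unfolding mirror_def
  by (induction a' a h x w y rule: runs.induct) auto

lemma colourable_rev:
  assumes "a * a' = 1"
  shows "nontrivially_colourable a a' e (rev w) \<longleftrightarrow> nontrivially_colourable a' a e w"
  unfolding nontrivially_colourable_def constant_mod_def runs_rev[OF assms] by simp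

lemma colourable_mirror:
  assumes "\<forall>(c, l, s) \<in> set w. s = 1 \<or> s = -1"
  shows "nontrivially_colourable a a' e (mirror w) \<longleftrightarrow> nontrivially_colourable a' a e w"
proof -
  have "labels (mirror w) = labels w" unfolding mirror_def by force
  then show ?thesis
    unfolding nontrivially_colourable_def constant_mod_def runs_mirror[OF assms] by simp
qed

text \<open>Reversal and mirror image each exchange \<open>a\<close> and \<open>a'\<close>, and
  together they cancel. Which alternative holds depends on the symmetry alone and not on
  \<open>e\<close>.\<close>

lemma diagram_of_colourable:
  fixes a a' :: "'r::comm_ring_1"
  assumes "diagram_of K D" "well_formed K" "a * a' = 1"
  shows "(\<forall>e. nontrivially_colourable a a' e D \<longleftrightarrow> nontrivially_colourable a a' e K) \<or>
    (\<forall>e. nontrivially_colourable a a' e D \<longleftrightarrow> nontrivially_colourable a' a e K)"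
proof -
  have inv': "a' * a = 1" using assms(3) by (simp add: mult.commute)
  have signs: "\<forall>(c, l, s) \<in> set K. s = 1 \<or> s = -1"
    using assms(2) by (auto simp: well_formed_def)
  then have signs': "\<forall>(c, l, s) \<in> set (rev K). s = 1 \<or> s = -1" by simp
  obtain K' where K': "K' \<in> {K, rev K, mirror K, mirror (rev K)}" "knot_equiv K' D"
    using assms(1) unfolding diagram_of_def by blast
  have D: "nontrivially_colourable a a' e D \<longleftrightarrow> nontrivially_colourable a a' e K'" for e
    using knot_equiv_colourable[OF assms(3) K'(2)] by simp
  have variants: "nontrivially_colourable a a' e (rev K) \<longleftrightarrow> nontrivially_colourable a' a e K"
    "nontrivially_colourable a a' e (mirror K) \<longleftrightarrow> nontrivially_colourable a' a e K"
    "nontrivially_colourable a a' e (mirror (rev K)) \<longleftrightarrow> nontrivially_colourable a a' e K" for e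
    using colourable_rev[OF assms(3)] colourable_rev[OF inv']
      colourable_mirror[OF signs] colourable_mirror[OF signs'] by blast+
  from K'(1) show ?thesis
    unfolding D by (elim insertE emptyE) (simp_all add: variants)
qed


section \<open>Evaluation of Laurent polynomials\<close>

definition int_power :: "'r::comm_ring_1 \<Rightarrow> 'r \<Rightarrow> int \<Rightarrow> 'r" where
  "int_power a a' k = (if k \<ge> 0 then a ^ nat k else a' ^ nat (- k))"

definition eval_laurent :: "'r::comm_ring_1 \<Rightarrow> 'r \<Rightarrow> laurent \<Rightarrow> 'r" where
  "eval_laurent a a' f =
     (\<Sum>k \<in> Poly_Mapping.keys f. of_int (Poly_Mapping.lookup f k) * int_power a a' k)"

lemma int_power_Suc:
  assumes "a * a' = 1"
  shows "int_power a a' (1 + k) = a * int_power a a' k"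
proof (cases "k \<ge> 0")
  case True
  then show ?thesis by (simp add: int_power_def nat_add_distrib)
next
  case False
  then have "nat (- k) = Suc (nat (- 1 - k))" by simp
  then have "a * int_power a a' k = (a * a') * a' ^ nat (- 1 - k)"
    using False by (simp add: int_power_def mult.assoc)
  also have "\<dots> = int_power a a' (1 + k)"
    using False assms by (cases "k = -1") (auto simp: int_power_def)
  finally show ?thesis ..
qed

lemma int_power_pred:
  assumes "a * a' = 1"
  shows "int_power a a' (- 1 + k) = a' * int_power a a' k"
proof -
  have "a' * int_power a a' k = (a * a') * int_power a a' (- 1 + k)"
    using int_power_Suc[OF assms, of "- 1 + k"] by (simp add: mult_ac)
  then show ?thesis using assms by simp
qed

lemma eval_laurent_zero [simp]: "eval_laurent a a' 0 = 0"
  by (simp add: eval_laurent_def)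

lemma eval_laurent_single: "eval_laurent a a' (Poly_Mapping.single k c) = of_int c * int_power a a' k"
  by (simp add: eval_laurent_def)

lemma eval_laurent_one [simp]: "eval_laurent a a' 1 = 1"
  by (simp add: eval_laurent_single int_power_def flip: single_one)

lemma eval_laurent_m_pow: "s = 1 \<or> s = -1 \<Longrightarrow> eval_laurent a a' (m_pow s) = (if s = 1 then a else a')"
  by (auto simp: m_pow_def eval_laurent_single int_power_def)

lemma eval_laurent_add [simp]: "eval_laurent a a' (f + g) = eval_laurent a a' f + eval_laurent a a' g"
  unfolding eval_laurent_def by (rule setsum_keys_plus_distrib) (simp_all add: distrib_right)

lemma eval_laurent_uminus [simp]: "eval_laurent a a' (- f) = - eval_laurent a a' f"
  by (metis add_eq_0_iff eval_laurent_add eval_laurent_zero right_minus)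

lemma eval_laurent_diff [simp]: "eval_laurent a a' (f - g) = eval_laurent a a' f - eval_laurent a a' g"
  by (metis eval_laurent_add diff_add_cancel eq_diff_eq)

lemma eval_laurent_sum: "eval_laurent a a' (\<Sum>i\<in>I. f i) = (\<Sum>i\<in>I. eval_laurent a a' (f i))"
  by (induction I rule: infinite_finite_induct) auto

text \<open>Row operations multiply only by \<open>m\<close>, its inverse and -1, so this much
  multiplicativity suffices; by additivity it is a question about monomials.\<close>

lemma eval_laurent_shift:
  assumes "a * a' = 1" "s = 1 \<or> s = -1"
  shows "eval_laurent a a' (m_pow s * f) = (if s = 1 then a else a') * eval_laurent a a' f"
proof -
  have "Poly_Mapping.keys f \<subseteq> UNIV" by simp
  then show ?thesis
  proof (induction f rule: frag_induction)
    case (one x)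
    then show ?case
      using assms(2) int_power_Suc[OF assms(1), of x] int_power_pred[OF assms(1), of x]
      by (auto simp: m_pow_def mult_single eval_laurent_single)
  next
    case (diff f g)
    then show ?case by (simp add: right_diff_distrib)
  qed auto
qed

lemma of_int_eval_laurent:
  "of_int (eval_laurent a a' f) = eval_laurent (of_int a) (of_int a') f"
  by (auto simp: eval_laurent_def int_power_def intro!: sum.cong)

section \<open>Kernels of matrices of Laurent polynomials\<close>

definition in_kernel :: "'r::comm_ring_1 \<Rightarrow> 'r \<Rightarrow> laurent mat \<Rightarrow> (nat \<Rightarrow> 'r) \<Rightarrow> bool" where
  "in_kernel a a' A X \<longleftrightarrow>
     (\<forall>i < dim_row A. (\<Sum>j < dim_col A. eval_laurent a a' (A $$ (i, j)) * X j) = 0)"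

definition nontrivial_kernel :: "'r::comm_ring_1 \<Rightarrow> 'r \<Rightarrow> 'r \<Rightarrow> laurent mat \<Rightarrow> bool" where
  "nontrivial_kernel a a' e A \<longleftrightarrow>
     (\<exists>X. in_kernel a a' A X \<and> (\<exists>i < dim_col A. \<exists>j < dim_col A. e * X i \<noteq> e * X j))"

text \<open>Puts the constant vectors into the kernel, whatever is substituted for
  \<open>m\<close>.\<close>

definition zero_row_sums :: "laurent mat \<Rightarrow> bool" where
  "zero_row_sums A \<longleftrightarrow> (\<forall>i < dim_row A. (\<Sum>j < dim_col A. A $$ (i, j)) = 0)"

text \<open>The factor evaluates to a unit \<open>r\<close>, which does not affect the vanishing of
  the row.\<close>

lemma in_kernel_multrow:
  fixes a a' :: "'r::comm_ring_1"
  assumes inv: "a * a' = 1" and k: "k < dim_row A" and u: "u \<in> {m_pow 1, m_pow (-1), -1}"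
  shows "in_kernel a a' (multrow k u A) X \<longleftrightarrow> in_kernel a a' A X"
proof -
  obtain r r' :: 'r where r: "r * r' = 1" "\<And>f. eval_laurent a a' (u * f) = r * eval_laurent a a' f"
  proof -
    consider "u = m_pow 1" | "u = m_pow (-1)" | "u = -1" using u by blast
    then show thesis
    proof cases
      case 1 then show thesis using that[of a a'] eval_laurent_shift[OF inv, of 1] inv by simp
    next
      case 2 then show thesis using that[of a' a] eval_laurent_shift[OF inv, of "-1"] inv
        by (simp add: mult.commute)
    next
      case 3 then show thesis using that[of "-1" "-1"] by simp
    qed
  qed
  define S where "S C i = (\<Sum>j < dim_col A. eval_laurent a a' (C $$ (i, j)) * X j)" for C i
  have row: "S (multrow k u A) i = (if i = k then r else 1) * S A i" if "i < dim_row A" for i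
    using that by (auto simp: S_def r sum_distrib_left mult.assoc intro!: sum.cong)
  have "r * x = 0 \<longleftrightarrow> x = 0" for x
    using r(1) by (metis mult.assoc mult.commute mult.left_neutral mult_zero_right)
  then have "(\<forall>i < dim_row A. S (multrow k u A) i = 0) \<longleftrightarrow> (\<forall>i < dim_row A. S A i = 0)"
    by (auto simp: row split: if_splits)
  then show ?thesis unfolding in_kernel_def index_mat_multrow(4,5) S_def .
qed

lemma in_kernel_addrow:
  assumes "k < dim_row A" "l < dim_row A" "k \<noteq> l"
  shows "in_kernel a a' (addrow 1 k l A) X \<longleftrightarrow> in_kernel a a' A X"
proof -
  define S where "S C i = (\<Sum>j < dim_col A. eval_laurent a a' (C $$ (i, j)) * X j)" for C i
  have row: "S (addrow 1 k l A) i = (if i = k then S A l + S A k else S A i)" if "i < dim_row A" for i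
    using that assms by (auto simp: S_def distrib_right simp flip: sum.distrib intro!: sum.cong)
  have "(\<forall>i < dim_row A. S (addrow 1 k l A) i = 0) \<longleftrightarrow> (\<forall>i < dim_row A. S A i = 0)"
  proof safe
    fix i assume zero: "\<forall>i < dim_row A. S (addrow 1 k l A) i = 0" and i: "i < dim_row A"
    have "S A l = 0" using zero assms row[of l] by auto
    then show "S A i = 0" using zero i row[of i] by (auto split: if_splits)
  qed (use assms in \<open>simp add: row\<close>)
  then show ?thesis unfolding in_kernel_def index_mat_addrow(4,5) S_def .
qed

lemma in_kernel_swaprows:
  assumes "k < dim_row A" "l < dim_row A"
  shows "in_kernel a a' (swaprows k l A) X \<longleftrightarrow> in_kernel a a' A X"
proof -
  define S where "S C i = (\<Sum>j < dim_col A. eval_laurent a a' (C $$ (i, j)) * X j)" for C i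
  have row: "S (swaprows k l A) i = S A (Transposition.transpose k l i)" if "i < dim_row A" for i
    using that assms by (auto simp: S_def Transposition.transpose_def intro!: sum.cong)
  have range: "Transposition.transpose k l i < dim_row A" if "i < dim_row A" for i
    using that assms by (auto simp: Transposition.transpose_def)
  have "(\<forall>i < dim_row A. S (swaprows k l A) i = 0) \<longleftrightarrow> (\<forall>i < dim_row A. S A i = 0)"
  proof safe
    fix i assume "\<forall>i < dim_row A. S (swaprows k l A) i = 0" and i: "i < dim_row A"
    then have "S (swaprows k l A) (Transposition.transpose k l i) = 0" using range by blast
    then show "S A i = 0" using row[OF range[OF i]] by simp
  qed (use range row in simp)
  then show ?thesis unfolding in_kernel_def index_mat_swaprows(2,3) S_def .
qed

lemma sum_swapcols:
  assumes "k < dim_col A" "l < dim_col A" "i < dim_row A"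
  shows "(\<Sum>j < dim_col A. F (swapcols k l A $$ (i, j)) * X (Transposition.transpose k l j)) =
    (\<Sum>j < dim_col A. F (A $$ (i, j)) * X j)"
proof (rule sum.reindex_bij_witness[of _ "Transposition.transpose k l" "Transposition.transpose k l"])
  fix j assume "j \<in> {..<dim_col A}"
  then show "F (A $$ (i, Transposition.transpose k l j)) * X (Transposition.transpose k l j) =
      F (swapcols k l A $$ (i, j)) * X (Transposition.transpose k l j)"
    using assms by (auto simp: Transposition.transpose_def)
qed (use assms in \<open>auto simp: Transposition.transpose_def\<close>)

lemma in_kernel_swapcols:
  assumes "k < dim_col A" "l < dim_col A"
  shows "in_kernel a a' (swapcols k l A) (X \<circ> Transposition.transpose k l) \<longleftrightarrow> in_kernel a a' A X"
  by (simp only: in_kernel_def index_mat_swapcols(2,3) comp_def sum_swapcols[OF assms] cong: imp_cong)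

text \<open>Row operations keep the kernel itself, and a column swap permutes the coordinates of its
  vectors; being nonconstant does not depend on the order of the coordinates.\<close>

lemma matrix_move_kernel:
  assumes "matrix_move A B" "a * a' = 1"
  shows "nontrivial_kernel a a' e A \<longleftrightarrow> nontrivial_kernel a a' e B"
  using assms(1)
proof cases
  case (1 k u)
  then show ?thesis using assms(2) by (simp add: nontrivial_kernel_def in_kernel_multrow)
next
  case (2 k l)
  then show ?thesis by (simp add: nontrivial_kernel_def in_kernel_addrow)
next
  case (3 k l)
  then show ?thesis by (simp add: nontrivial_kernel_def in_kernel_swaprows)
next
  case (4 k l)
  let ?t = "Transposition.transpose k l"
  have range: "?t j < dim_col A" if "j < dim_col A" for j
    using that 4 by (auto simp: Transposition.transpose_def)
  have eq: "in_kernel a a' B (X \<circ> ?t) \<longleftrightarrow> in_kernel a a' A X" for X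
    using 4 in_kernel_swapcols by metis
  have dim: "dim_col B = dim_col A" using 4 by simp
  show ?thesis
    unfolding nontrivial_kernel_def dim
  proof safe
    fix X i j assume X: "in_kernel a a' A X" "i < dim_col A" "j < dim_col A" "e * X i \<noteq> e * X j"
    then show "\<exists>X. in_kernel a a' B X \<and> (\<exists>i<dim_col A. \<exists>j<dim_col A. e * X i \<noteq> e * X j)"
      using eq range by (intro exI[of _ "X \<circ> ?t"] conjI exI[of _ "?t i"] exI[of _ "?t j"]) auto
  next
    fix X i j assume X: "in_kernel a a' B X" "i < dim_col A" "j < dim_col A" "e * X i \<noteq> e * X j"
    then show "\<exists>X. in_kernel a a' A X \<and> (\<exists>i<dim_col A. \<exists>j<dim_col A. e * X i \<noteq> e * X j)"
      using eq[of "X \<circ> ?t"] range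
      by (intro exI[of _ "X \<circ> ?t"] conjI exI[of _ "?t i"] exI[of _ "?t j"]) (auto simp: comp_assoc)
  qed
qed

lemma matrix_move_row_sums:
  assumes "matrix_move A B" "zero_row_sums A"
  shows "zero_row_sums B"
  using assms(1)
proof cases
  case (1 k u)
  have "(\<Sum>j < dim_col A. multrow k u A $$ (i, j)) = 0" if "i < dim_row A" for i
    using that assms(2) by (cases "i = k") (simp_all add: zero_row_sums_def flip: sum_distrib_left)
  then show ?thesis by (simp only: 1 zero_row_sums_def index_mat_multrow(4,5)) blast
next
  case (2 k l)
  have "(\<Sum>j < dim_col A. addrow 1 k l A $$ (i, j)) = 0" if "i < dim_row A" for i
    using that assms(2) 2 by (cases "i = k") (simp_all add: zero_row_sums_def sum.distrib)
  then show ?thesis by (simp only: 2 zero_row_sums_def index_mat_addrow(4,5)) blast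
next
  case (3 k l)
  have "(\<Sum>j < dim_col A. swaprows k l A $$ (i, j)) = 0" if "i < dim_row A" for i
    using that assms(2) 3 by (cases "i = k"; cases "i = l") (simp_all add: zero_row_sums_def)
  then show ?thesis by (simp only: 3 zero_row_sums_def index_mat_swaprows(2,3)) blast
next
  case (4 k l)
  have "(\<Sum>j < dim_col A. swapcols k l A $$ (i, j)) = 0" if "i < dim_row A" for i
    using that assms(2) sum_swapcols[OF 4(2,3) that, of "\<lambda>x. x" "\<lambda>_. 1"]
    by (simp only: zero_row_sums_def mult_1_right)
  then show ?thesis by (simp only: 4 zero_row_sums_def index_mat_swapcols(2,3)) blast
qed

lemma matrix_move_dim: "matrix_move A B \<Longrightarrow> dim_row B = dim_row A \<and> dim_col B = dim_col A"
  by (induction rule: matrix_move.induct) auto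

lemma matrix_equivalent_kernel:
  assumes "matrix_equivalent A B" "a * a' = 1"
  shows "nontrivial_kernel a a' e A \<longleftrightarrow> nontrivial_kernel a a' e B"
  using assms(1) unfolding matrix_equivalent_def
  by (induction rule: rtranclp_induct) (use matrix_move_kernel[OF _ assms(2)] in blast)+

lemma matrix_equivalent_row_sums:
  assumes "matrix_equivalent A B" "zero_row_sums A"
  shows "zero_row_sums B"
  using assms unfolding matrix_equivalent_def
  by (induction rule: rtranclp_induct) (use matrix_move_row_sums in blast)+

lemma matrix_equivalent_dim:
  assumes "matrix_equivalent A B"
  shows "dim_row B = dim_row A \<and> dim_col B = dim_col A"
  using assms unfolding matrix_equivalent_def
proof (induction rule: rtranclp_induct)
  case (step B C)
  then show ?case using matrix_move_dim[OF step.hyps(2)] by simp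
qed simp

section \<open>Kernels of triangular matrices\<close>

lemma triangular_row:
  fixes X :: "nat \<Rightarrow> 'r::comm_ring_1"
  assumes "upper_triangular B" "B \<in> carrier_mat n n" "i < n"
  shows "(\<Sum>j < n. eval_laurent a a' (B $$ (i, j)) * X j) =
    eval_laurent a a' (B $$ (i, i)) * X i + (\<Sum>j \<in> {i<..<n}. eval_laurent a a' (B $$ (i, j)) * X j)"
proof -
  let ?F = "\<lambda>j. eval_laurent a a' (B $$ (i, j)) * X j"
  have "B $$ (i, j) = 0" if "j < i" for j
    using upper_triangularD[OF assms(1) that] assms(2,3) by simp
  then have "(\<Sum>j < n. ?F j) = (\<Sum>j \<in> insert i {i<..<n}. ?F j)"
    using assms(3) by (intro sum.mono_neutral_right) (auto simp: not_less le_less)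
  then show ?thesis by simp
qed

text \<open>Vanishing row sums allow the constant \<open>X (n - 1)\<close> to be subtracted; back
  substitution from below then kills the other coordinates. The last diagonal entry is exempt from
  \<open>unit\<close>, as its row sum makes it zero.\<close>

lemma triangular_kernel_trivial:
  fixes X :: "nat \<Rightarrow> 'r::comm_ring_1"
  assumes tri: "upper_triangular B" "B \<in> carrier_mat n n" and sums: "zero_row_sums B"
    and unit: "\<And>i. Suc i < n \<Longrightarrow> \<exists>u. u * eval_laurent a a' (B $$ (i, i)) = 1"
    and ker: "in_kernel a a' B X" and i: "i < n"
  shows "X i = X (n - 1)"
  using i
proof (induction "n - i" arbitrary: i rule: less_induct)
  case less
  let ?F = "\<lambda>j. eval_laurent a a' (B $$ (i, j))"
  show ?case
  proof (cases "Suc i < n")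
    case True
    then obtain u where u: "u * ?F i = 1" using unit by blast
    have later: "X j = X (n - 1)" if "j \<in> {i<..<n}" for j
      using that less.prems by (intro less.hyps) auto
    have "eval_laurent a a' (\<Sum>j < n. B $$ (i, j)) = 0"
      using sums tri(2) less.prems by (simp add: zero_row_sums_def)
    then have zero: "(\<Sum>j < n. ?F j) = 0" by (simp add: eval_laurent_sum)
    have "(\<Sum>j < n. ?F j * X j) = 0"
      using ker tri(2) less.prems by (simp add: in_kernel_def)
    then have "(\<Sum>j < n. ?F j * (X j - X (n - 1))) = 0"
      using zero by (simp add: right_diff_distrib sum_subtractf flip: sum_distrib_right)
    then have "?F i * (X i - X (n - 1)) = 0"
      using triangular_row[OF tri less.prems, of a a' "\<lambda>j. X j - X (n - 1)"] later by simp
    then have "(u * ?F i) * (X i - X (n - 1)) = 0" by (simp add: mult.assoc)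
    then show ?thesis by (simp add: u)
  next
    case False
    with less.prems have "i = n - 1" by simp
    then show ?thesis by simp
  qed
qed

text \<open>Since the pivot of row \<open>i\<close> vanishes, coordinate \<open>i\<close> may be set
  to 1 and all later ones to 0. The earlier coordinates follow in descending order by dividing by
  unit pivots.\<close>

lemma triangular_kernel_exists:
  fixes a a' :: "'r::comm_ring_1"
  assumes tri: "upper_triangular B" "B \<in> carrier_mat n n" and i: "i < n"
    and zero: "eval_laurent a a' (B $$ (i, i)) = 0"
    and unit: "\<And>l. l < i \<Longrightarrow> \<exists>u. u * eval_laurent a a' (B $$ (l, l)) = 1"
  obtains X where "in_kernel a a' B X" "X i = 1" "\<And>j. i < j \<Longrightarrow> X j = 0"
proof -
  let ?row = "\<lambda>X r. \<Sum>j < n. eval_laurent a a' (B $$ (r, j)) * X j"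
  \<comment> \<open>\<open>m\<close> counts the rows above row \<open>i\<close> that are already
    solved. The subtraction \<open>i - m\<close> is truncated, so \<open>m = i\<close> reaches row
    0.\<close>
  have "\<exists>X. X i = 1 \<and> (\<forall>j > i. X j = 0) \<and> (\<forall>r < n. i - m \<le> r \<longrightarrow> ?row X r = 0)" for m
  proof (induction m)
    case 0
    have "?row (\<lambda>j. if j = i then 1 else 0) r = 0" if "r < n" "i \<le> r" for r
      using triangular_row[OF tri that(1), of a a' "\<lambda>j. if j = i then 1 else 0"] zero that
      by (cases "r = i") auto
    then show ?case by (intro exI[of _ "\<lambda>j. if j = i then 1 else 0"]) auto
  next
    case (Suc m)
    then obtain X where X: "X i = 1" "\<forall>j > i. X j = 0" "\<forall>r < n. i - m \<le> r \<longrightarrow> ?row X r = 0" by blast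
    show ?case
    proof (cases "m < i")
      case True
      define l where "l = i - Suc m"
      have l: "l < i" "i - m = Suc l" using True by (auto simp: l_def)
      then obtain u where u: "u * eval_laurent a a' (B $$ (l, l)) = 1" using unit by blast
      let ?s = "\<Sum>j \<in> {l<..<n}. eval_laurent a a' (B $$ (l, j)) * X j"
      define Y where "Y = X(l := - u * ?s)"
      have same: "(\<Sum>j \<in> {r<..<n}. eval_laurent a a' (B $$ (r, j)) * Y j) =
          (\<Sum>j \<in> {r<..<n}. eval_laurent a a' (B $$ (r, j)) * X j)" if "l \<le> r" for r
        using that by (intro sum.cong) (auto simp: Y_def)
      have "?row Y r = 0" if r: "r < n" "l \<le> r" for r
      proof (cases "r = l")
        case True
        have "?row Y r = eval_laurent a a' (B $$ (l, l)) * (- u * ?s) + ?s"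
          using triangular_row[OF tri r(1), of a a' Y] same[OF r(2)] by (simp add: True Y_def)
        also have "\<dots> = (1 - u * eval_laurent a a' (B $$ (l, l))) * ?s"
          by (simp add: algebra_simps)
        finally show ?thesis by (simp add: u)
      next
        case False
        then have "Y r = X r" by (simp add: Y_def)
        then have "?row Y r = ?row X r"
          unfolding triangular_row[OF tri r(1)] same[OF r(2)] by simp
        then show ?thesis using X(3) r False l(2) by simp
      qed
      then show ?thesis
        using X(1,2) l by (intro exI[of _ Y]) (auto simp: Y_def l_def)
    next
      case False
      then show ?thesis using X by (intro exI[of _ X]) auto
    qed
  qed
  from this[of i] obtain X where "X i = 1" "\<forall>j > i. X j = 0" "\<forall>r < n. ?row X r = 0" by auto
  then show thesis using that[of X] tri(2) by (auto simp: in_kernel_def)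
qed

section \<open>Colourings as solutions of the colouring matrix\<close>

text \<open>Prefixes of the list of lower passages correspond to arcs: the first \<open>k\<close> of
  them lead from arc 0 to arc \<open>k\<close>.\<close>

definition under_colour :: "'r::comm_ring_1 \<Rightarrow> 'r \<Rightarrow> (nat \<Rightarrow> 'r) \<Rightarrow> 'r \<Rightarrow> passage list \<Rightarrow> 'r" where
  "under_colour a a' h x us =
     fold (\<lambda>(c, l, s) y. quandle_op (if s = 1 then a else a') y (h c)) us x"

lemma under_passages_simps [simp]:
  "under_passages [] = []"
  "under_passages ((c, Under, s) # w) = (c, Under, s) # under_passages w"
  "under_passages ((c, Over, s) # w) = under_passages w"
  "under_passages (u @ v) = under_passages u @ under_passages v"
  by (simp_all add: under_passages_def)

text \<open>The colour changes at lower passages only; upper passages merely demand that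
  \<open>h\<close> records the current colour.\<close>

lemma runs_iff_under_colour:
  "runs a a' h x w y \<longleftrightarrow> y = under_colour a a' h x (under_passages w) \<and>
     (\<forall>n < length w. \<forall>c s. w ! n = (c, Over, s) \<longrightarrow>
        h c = under_colour a a' h x (under_passages (take n w)))"
proof (induction a a' h x w y rule: runs.induct)
  case (1 a a' h x y)
  then show ?case by (auto simp: under_colour_def)
next
  case (2 a a' h x c s w y)
  then show ?case by (auto simp: under_colour_def All_less_Suc2)
next
  case (3 a a' h x c s w y)
  then show ?case by (auto simp: under_colour_def All_less_Suc2)
qed

lemma under_colour_snoc:
  "under_colour a a' h x (us @ [(c, l, s)]) =
     quandle_op (if s = 1 then a else a') (under_colour a a' h x us) (h c)"
  by (simp add: under_colour_def)

lemma over_arc_nth: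
  assumes "well_formed w" "n < length w"
  shows "over_arc w (w ! n) =
    length (under_passages (take n w)) mod length (under_passages w)"
proof -
  have "distinct w" using assms(1) by (simp add: well_formed_def)
  then have "takeWhile (\<lambda>y. y \<noteq> w ! n) w = take n w"
    using assms(2) by (intro takeWhile_eq_take_P_nth) (auto simp: nth_eq_iff_index_eq)
  then show ?thesis by (simp add: over_arc_def)
qed

lemma under_passages_take:
  "under_passages (take n w) = take (length (under_passages (take n w))) (under_passages w)"
  by (metis append_eq_conv_conj append_take_drop_id under_passages_simps(4))

context
  fixes w :: gauss_code and us :: "passage list" and N :: nat and a a' :: "'r::comm_ring_1"
  assumes wf: "well_formed w"
  defines "us \<equiv> under_passages w"
  defines "N \<equiv> length us"
begin

lemma under_passages_nth: "k < N \<Longrightarrow> \<exists>c s. us ! k = (c, Under, s) \<and> us ! k \<in> set w \<and> (s = 1 \<or> s = -1)"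
proof -
  assume "k < N"
  then have "us ! k \<in> set us" by (simp add: N_def)
  moreover obtain c l s where x: "us ! k = (c, l, s)" by (cases "us ! k")
  ultimately have "l = Under" "(c, l, s) \<in> set w" by (auto simp: us_def under_passages_def)
  then show ?thesis using well_formed_sign[OF wf] x by auto
qed

lemma over_arc_less: "k < N \<Longrightarrow> over_arc w x < N"
  unfolding over_arc_def N_def us_def by (rule mod_less_divisor) linarith

lemma colouring_matrix_carrier: "colouring_matrix w \<in> carrier_mat N N"
  by (simp add: colouring_matrix_def N_def us_def Let_def)

text \<open>The three summands of an entry are summed separately over the columns, which also covers
  coinciding arcs.\<close>

lemma colouring_matrix_row:
  fixes X :: "nat \<Rightarrow> 'r"
  assumes "k < N" "us ! k = (c, Under, s)"
  shows "(\<Sum>j < N. eval_laurent a a' (colouring_matrix w $$ (k, j)) * X j) =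
    quandle_op (if s = 1 then a else a') (X k) (X (over_arc w (c, Over, s))) - X (Suc k mod N)"
proof -
  let ?t = "if s = 1 then a else a'" and ?o = "over_arc w (c, Over, s)"
  have s: "s = 1 \<or> s = -1" using under_passages_nth[OF assms(1)] assms(2) by auto
  have o: "?o < N" and suc: "Suc k mod N < N" using assms(1) over_arc_less by auto
  have "eval_laurent a a' (colouring_matrix w $$ (k, j)) * X j =
      (if j = k then ?t * X j else 0) + (if j = ?o then (1 - ?t) * X j else 0)
      - (if j = Suc k mod N then X j else 0)" if "j < N" for j
    using assms that eval_laurent_m_pow[OF s, of a a']
    by (auto simp: colouring_matrix_def Let_def algebra_simps simp flip: us_def N_def)
  then have "(\<Sum>j < N. eval_laurent a a' (colouring_matrix w $$ (k, j)) * X j) =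
      (\<Sum>j < N. (if j = k then ?t * X j else 0) + (if j = ?o then (1 - ?t) * X j else 0)
      - (if j = Suc k mod N then X j else 0))"
    by (intro sum.cong) auto
  also have "\<dots> = ?t * X k + (1 - ?t) * X ?o - X (Suc k mod N)"
    using assms(1) o suc by (simp add: sum.distrib sum_subtractf)
  finally show ?thesis by (simp add: quandle_op_def)
qed

lemma colouring_matrix_kernel:
  "in_kernel a a' (colouring_matrix w) X \<longleftrightarrow> (\<forall>k < N. \<forall>c s. us ! k = (c, Under, s) \<longrightarrow>
     X (Suc k mod N) = quandle_op (if s = 1 then a else a') (X k) (X (over_arc w (c, Over, s))))"
proof -
  have "in_kernel a a' (colouring_matrix w) X \<longleftrightarrow>
      (\<forall>k < N. (\<Sum>j < N. eval_laurent a a' (colouring_matrix w $$ (k, j)) * X j) = 0)"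
    using colouring_matrix_carrier by (auto simp: in_kernel_def)
  also have "\<dots> \<longleftrightarrow> (\<forall>k < N. \<forall>c s. us ! k = (c, Under, s) \<longrightarrow>
     X (Suc k mod N) = quandle_op (if s = 1 then a else a') (X k) (X (over_arc w (c, Over, s))))"
  proof (intro iffI allI impI)
    fix k assume k: "k < N" and X: "\<forall>k < N. \<forall>c s. us ! k = (c, Under, s) \<longrightarrow>
       X (Suc k mod N) = quandle_op (if s = 1 then a else a') (X k) (X (over_arc w (c, Over, s)))"
    obtain c s where "us ! k = (c, Under, s)" using under_passages_nth[OF k] by blast
    then show "(\<Sum>j < N. eval_laurent a a' (colouring_matrix w $$ (k, j)) * X j) = 0"
      using colouring_matrix_row[OF k] X k by simp
  next
    fix k c s assume zero: "\<forall>k < N. (\<Sum>j < N. eval_laurent a a' (colouring_matrix w $$ (k, j)) * X j) = 0"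
      and k: "k < N" "us ! k = (c, Under, s)"
    have "quandle_op (if s = 1 then a else a') (X k) (X (over_arc w (c, Over, s))) - X (Suc k mod N) = 0"
      using zero k(1) unfolding colouring_matrix_row[OF k, symmetric] by blast
    then show "X (Suc k mod N) = quandle_op (if s = 1 then a else a') (X k) (X (over_arc w (c, Over, s)))"
      by (simp only: right_minus_eq)
  qed
  finally show ?thesis .
qed

lemma zero_row_sums_colouring_matrix: "zero_row_sums (colouring_matrix w)"
proof -
  have "(\<Sum>j < N. colouring_matrix w $$ (k, j)) = 0" if k: "k < N" for k
  proof -
    let ?x = "us ! k"
    let ?t = "m_pow (snd (snd ?x))" and ?o = "over_arc w (partner ?x)"
    have "(\<Sum>j < N. colouring_matrix w $$ (k, j)) = (\<Sum>j < N. (if j = k then ?t else 0)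
        + (if j = ?o then 1 - ?t else 0) - (if j = Suc k mod N then 1 else 0))"
      using k by (intro sum.cong) (auto simp: colouring_matrix_def Let_def simp flip: us_def N_def)
    also have "\<dots> = 0"
      using k over_arc_less[OF k] by (simp add: sum.distrib sum_subtractf)
    finally show ?thesis .
  qed
  then show ?thesis using colouring_matrix_carrier by (auto simp: zero_row_sums_def)
qed

text \<open>An upper passage behind the last lower one lies on arc 0. This is the case
  \<open>k = N\<close> of the hypothesis, where the walk closes up.\<close>

lemma over_passage_colour:
  assumes X: "\<And>k. k \<le> N \<Longrightarrow> X (k mod N) = under_colour a a' h q (take k us)"
    and n: "n < length w"
  shows "under_colour a a' h q (under_passages (take n w)) = X (over_arc w (w ! n))"
proof -
  have "length (under_passages (take n w)) \<le> N"
    by (subst under_passages_take) (simp add: N_def us_def)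
  then show ?thesis
    using X under_passages_take[of n w] over_arc_nth[OF wf n] by (simp add: us_def N_def)
qed

lemma colouring_imp_kernel:
  assumes "runs a a' h q w q" "\<not> constant_mod e h q w"
  shows "nontrivial_kernel a a' e (colouring_matrix w)"
proof -
  \<comment> \<open>The colour of arc \<open>k\<close> read off from the walk; \<open>X N\<close> is
    the colour on return and equals \<open>X 0\<close>.\<close>
  define X where "X k = under_colour a a' h q (take k us)" for k
  have q: "X N = q" and over: "\<And>n c s. n < length w \<Longrightarrow> w ! n = (c, Over, s) \<Longrightarrow>
      h c = under_colour a a' h q (under_passages (take n w))"
    using assms(1) unfolding runs_iff_under_colour by (auto simp: X_def us_def N_def)
  have q0: "X 0 = q" by (simp add: X_def under_colour_def)
  have mod: "X (k mod N) = X k" if "k \<le> N" for k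
    using that q q0 by (cases "k = N") auto
  have hc: "h c = X (over_arc w (c, Over, s))" if x: "(c, Over, s) \<in> set w" for c s
  proof -
    obtain n where n: "n < length w" "w ! n = (c, Over, s)" using x by (auto simp: in_set_conv_nth)
    show ?thesis
      using over[OF n] over_passage_colour[of X h q n] mod n by (simp add: X_def)
  qed
  obtain c where c: "c \<in> labels w" "e * h c \<noteq> e * q"
    using assms(2) by (auto simp: constant_mod_def)
  then obtain l s where "(c, l, s) \<in> set w" by auto
  then have x: "(c, Over, s) \<in> set w" "(c, Under, s) \<in> set w"
    using well_formed_partner[OF wf] by (cases l; force)+
  then have "us \<noteq> []" by (auto simp: us_def under_passages_def filter_empty_conv)
  then have N: "0 < N" by (simp add: N_def)
  have "in_kernel a a' (colouring_matrix w) X"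
    unfolding colouring_matrix_kernel
  proof (intro allI impI)
    fix k c s assume k: "k < N" "us ! k = (c, Under, s)"
    then have "(c, Over, s) \<in> set w"
      using under_passages_nth[OF k(1)] well_formed_partner[OF wf, of c Under s] by auto
    moreover have "X (Suc k) = quandle_op (if s = 1 then a else a') (X k) (h c)"
      using k under_colour_snoc[of a a' h q "take k us" c Under s]
      by (simp add: X_def take_Suc_conv_app_nth N_def)
    ultimately show "X (Suc k mod N) = quandle_op (if s = 1 then a else a') (X k) (X (over_arc w (c, Over, s)))"
      using mod[of "Suc k"] k hc by simp
  qed
  moreover have "e * X (over_arc w (c, Over, s)) \<noteq> e * X 0"
    using c(2) hc[OF x(1)] q0 by simp
  moreover have "dim_col (colouring_matrix w) = N" using colouring_matrix_carrier by simp
  ultimately show ?thesis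
    unfolding nontrivial_kernel_def using over_arc_less[OF N] N by metis
qed

lemma kernel_imp_colouring:
  assumes ker: "in_kernel a a' (colouring_matrix w) X"
    and ij: "i < N" "j < N" "e * X i \<noteq> e * X j"
  shows "nontrivially_colourable a a' e w"
proof -
  \<comment> \<open>The matrix refers to an upper passage together with its sign, whereas
    \<open>h\<close> sees only the label; in a well-formed code the label determines the
    sign.\<close>
  define sgn where "sgn c = (SOME s. (c, Over, s) \<in> set w)" for c
  define h where "h c = X (over_arc w (c, Over, sgn c))" for c
  have hc: "h c = X (over_arc w (c, Over, s))" if "(c, Over, s) \<in> set w" for c s
  proof -
    have "(c, Over, sgn c) \<in> set w" unfolding sgn_def using that by (rule someI)
    then have "sgn c = s" using well_formed_same_sign[OF wf that] by blast
    then show ?thesis by (simp add: h_def)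
  qed
  have X: "X (k mod N) = under_colour a a' h (X 0) (take k us)" if "k \<le> N" for k
    using that
  proof (induction k)
    case 0
    then show ?case by (simp add: under_colour_def)
  next
    case (Suc k)
    then have k: "k < N" by simp
    obtain c s where us: "us ! k = (c, Under, s)" "(c, Under, s) \<in> set w"
      using under_passages_nth[OF k] by auto
    have "(c, Over, s) \<in> set w" using well_formed_partner[OF wf us(2)] by simp
    then have "X (Suc k mod N) = quandle_op (if s = 1 then a else a') (X k) (h c)"
      using ker k us(1) hc unfolding colouring_matrix_kernel by auto
    then show ?case
      using Suc k us under_colour_snoc[of a a' h "X 0" "take k us" c Under s]
      by (simp add: take_Suc_conv_app_nth N_def)
  qed
  have "runs a a' h (X 0) w (X 0)"
    unfolding runs_iff_under_colour
  proof (intro conjI allI impI)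
    show "X 0 = under_colour a a' h (X 0) (under_passages w)"
      using X[of N] by (simp add: us_def N_def)
    fix n c s assume n: "n < length w" "w ! n = (c, Over, s)"
    then have "(c, Over, s) \<in> set w" by (metis nth_mem)
    then show "h c = under_colour a a' h (X 0) (under_passages (take n w))"
      using over_passage_colour[OF X n(1)] hc n(2) by simp
  qed
  moreover have "\<not> constant_mod e h (X 0) w"
  proof
    assume const: "constant_mod e h (X 0) w"
    \<comment> \<open>If all upper colours agree with that of arc 0 modulo the annihilator of
      \<open>e\<close>, then so do all arcs, one lower passage after the other.\<close>
    have "e * X k = e * X 0" if "k < N" for k
      using that
    proof (induction k)
      case (Suc k)
      then have k: "k < N" by simp
      obtain c s where us: "us ! k = (c, Under, s)" "(c, Under, s) \<in> set w"
        using under_passages_nth[OF k] by auto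
      have "X (Suc k) = quandle_op (if s = 1 then a else a') (X k) (X (over_arc w (c, Over, s)))"
        using ker k us(1) Suc.prems unfolding colouring_matrix_kernel by (metis mod_less)
      moreover have "(c, Over, s) \<in> set w" using well_formed_partner[OF wf us(2)] by simp
      moreover have "e * h c = e * X 0" using const us(2) by (force simp: constant_mod_def)
      ultimately show ?case using Suc.IH k hc by (simp add: quandle_op_constant)
    qed simp
    with ij show False by metis
  qed
  ultimately show ?thesis unfolding nontrivially_colourable_def by blast
qed

lemma kernel_iff_colourable:
  "nontrivial_kernel a a' e (colouring_matrix w) \<longleftrightarrow> nontrivially_colourable a a' e w"
proof
  have dim: "dim_col (colouring_matrix w) = N" using colouring_matrix_carrier by simp
  assume "nontrivial_kernel a a' e (colouring_matrix w)"
  then obtain X i j where "in_kernel a a' (colouring_matrix w) X" "i < N" "j < N" "e * X i \<noteq> e * X j"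
    unfolding nontrivial_kernel_def dim by blast
  then show "nontrivially_colourable a a' e w" by (rule kernel_imp_colouring)
next
  assume "nontrivially_colourable a a' e w"
  then obtain h q where "runs a a' h q w q" "\<not> constant_mod e h q w"
    unfolding nontrivially_colourable_def by blast
  then show "nontrivial_kernel a a' e (colouring_matrix w)" by (rule colouring_imp_kernel)
qed

end

section \<open>A criterion for non-triangularizability\<close>

definition ipoly :: "int poly \<Rightarrow> 'r::comm_ring_1 \<Rightarrow> 'r" where
  "ipoly f x = poly (map_poly of_int f) x"

lemma ipoly_0 [simp]: "ipoly 0 x = 0"
  by (simp add: ipoly_def)

lemma ipoly_pCons [simp]: "ipoly (pCons c f) x = of_int c + x * ipoly f x"
  by (simp add: ipoly_def map_poly_pCons)

lemma ipoly_monom: "ipoly (monom c n) x = of_int c * x ^ n"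
  by (simp add: ipoly_def map_poly_monom poly_monom)

lemma ipoly_add: "ipoly (f + g) x = ipoly f x + ipoly g x"
  by (induction f g rule: poly_induct2) (simp_all add: algebra_simps)

lemma ipoly_sum: "ipoly (\<Sum>i\<in>I. f i) x = (\<Sum>i\<in>I. ipoly (f i) x)"
  by (induction I rule: infinite_finite_induct) (simp_all add: ipoly_add)

text \<open>The Taylor expansion, whose higher terms contain \<open>s * s\<close>.\<close>

lemma ipoly_nilpotent:
  assumes "s * s = 0"
  shows "ipoly f (of_int x + s) = of_int (poly f x) + s * of_int (poly (pderiv f) x)"
proof (induction f)
  case (pCons c f)
  have "ipoly (pCons c f) (of_int x + s) = of_int c + of_int x * of_int (poly f x)
      + s * (of_int (poly f x) + of_int x * of_int (poly (pderiv f) x))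
      + (s * s) * of_int (poly (pderiv f) x)"
    unfolding ipoly_pCons pCons.IH by (simp add: algebra_simps)
  then show ?case by (simp add: assms pderiv_pCons)
qed simp

lemma ipoly_of_int: "ipoly f (of_int x) = of_int (poly f x)"
  using ipoly_nilpotent[of 0 f x] by simp

lemma poly_taylor2:
  fixes f :: "int poly"
  shows "\<exists>c. poly f (x + y) = poly f x + y * poly (pderiv f) x + y * y * c"
proof (induction f)
  case (pCons b f)
  then obtain c where "poly f (x + y) = poly f x + y * poly (pderiv f) x + y * y * c" by blast
  then have "poly (pCons b f) (x + y) = poly (pCons b f) x + y * poly (pderiv (pCons b f)) x
      + y * y * (poly (pderiv f) x + (x + y) * c)"
    by (simp add: pderiv_pCons algebra_simps)
  then show ?case ..
qed simp

lemma poly_cong: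
  fixes f :: "int poly"
  assumes "[x = y] (mod n)"
  shows "[poly f x = poly f y] (mod n)"
proof -
  obtain c where c: "x = y + n * c"
    using assms by (metis cong_iff_lin cong_sym)
  obtain d where "poly f (y + n * c) = poly f y + n * c * poly (pderiv f) y + n * c * (n * c) * d"
    using poly_taylor2 by blast
  then have "poly f x = poly f y + n * (c * poly (pderiv f) y + c * (n * c) * d)"
    by (simp add: c algebra_simps)
  then show ?thesis by (simp add: cong_iff_dvd_diff)
qed

text \<open>Newton's method: a root modulo \<open>p^k\<close> is corrected by a multiple of
  \<open>p^k\<close>, and the derivative stays invertible modulo \<open>p\<close>.\<close>

lemma hensel:
  fixes f :: "int poly" and p :: int
  assumes "prime p" "p dvd poly f x" "\<not> p dvd poly (pderiv f) x" "k \<ge> 1"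
  shows "\<exists>y. [y = x] (mod p) \<and> p ^ k dvd poly f y"
  using \<open>k \<ge> 1\<close>
proof (induction k rule: dec_induct)
  case base
  show ?case using assms(2) by (intro exI[of _ x]) simp
next
  case (step k)
  from step.IH obtain y where y: "[y = x] (mod p)" and "p ^ k dvd poly f y" by blast
  then obtain r where r: "poly f y = p ^ k * r" by (elim dvdE)
  have "\<not> p dvd poly (pderiv f) y"
    using assms(3) poly_cong[OF y] cong_dvd_iff by blast
  then have "coprime (poly (pderiv f) y) p"
    using assms(1) by (simp add: prime_imp_coprime coprime_commute)
  then obtain v where "[poly (pderiv f) y * v = 1] (mod p)" using cong_solve_coprime_int by blast
  then have v: "p dvd poly (pderiv f) y * v - 1" by (simp add: cong_iff_dvd_diff)
  \<comment> \<open>The Newton correction: \<open>v\<close> inverts the derivative modulo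
    \<open>p\<close>, so the linear Taylor term cancels \<open>r\<close> modulo
    \<open>p\<close>.\<close>
  define c where "c = - r * v"
  obtain d where d: "poly f (y + p ^ k * c) = poly f y + p ^ k * c * poly (pderiv f) y + p ^ k * c * (p ^ k * c) * d"
    using poly_taylor2 by blast
  have "r + c * poly (pderiv f) y = - r * (poly (pderiv f) y * v - 1)"
    by (simp add: c_def algebra_simps)
  then have "p dvd r + c * poly (pderiv f) y" using v by (metis dvd_mult)
  then have "p ^ Suc k dvd p ^ k * (r + c * poly (pderiv f) y)" by simp
  \<comment> \<open>As \<open>k\<close> is at least 1, the exponent \<open>2k\<close> of the
    quadratic Taylor term is at least \<open>k + 1\<close>.\<close>
  moreover have "p ^ Suc k dvd p ^ k * p ^ k"
    unfolding power_add[symmetric] by (rule le_imp_power_dvd) (use step.hyps(1) in simp)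
  ultimately have "p ^ Suc k dvd p ^ k * (r + c * poly (pderiv f) y) + p ^ k * p ^ k * (c * c * d)"
    by (rule dvd_add[OF _ dvd_mult2])
  also have "\<dots> = poly f (y + p ^ k * c)" unfolding d r by (simp add: algebra_simps)
  finally have "p ^ Suc k dvd poly f (y + p ^ k * c)" .
  moreover have "p dvd p ^ k * c" using step.hyps(1) by (intro dvd_mult2 dvd_power) simp
  then have "[y + p ^ k * c = x] (mod p)"
    using y by (metis add.commute add_diff_eq cong_iff_dvd_diff dvd_add)
  ultimately show ?case by blast
qed

text \<open>A Bezout relation between \<open>c\<close> and \<open>n\<close> loses its second term in
  the ring.\<close>

lemma of_int_unit:
  assumes "of_int n = (0::'r::comm_ring_1)" "coprime c n"
  shows "\<exists>u. u * of_int c = (1::'r)"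
proof -
  obtain u v where "u * c + v * n = 1" using assms(2) bezout_int[of c n] by auto
  then have "of_int u * of_int c + of_int v * of_int n = (1::'r)" by (metis of_int_1 of_int_add of_int_mult)
  then show ?thesis using assms(1) by auto
qed

text \<open>A crude bound on the exponents: multiplication by this power of \<open>m\<close> removes
  all negative ones and leads to \<open>laurent_poly\<close>.\<close>

definition laurent_shift :: "laurent \<Rightarrow> nat" where
  "laurent_shift f = (\<Sum>k \<in> Poly_Mapping.keys f. nat \<bar>k\<bar>)"

definition laurent_poly :: "laurent \<Rightarrow> int poly" where
  "laurent_poly f = (\<Sum>k \<in> Poly_Mapping.keys f.
     monom (Poly_Mapping.lookup f k) (nat (k + int (laurent_shift f))))"

lemma eval_laurent_poly:
  fixes a a' :: "'r::comm_ring_1"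
  assumes inv: "a * a' = 1"
  shows "eval_laurent a a' f * a ^ laurent_shift f = ipoly (laurent_poly f) a"
proof -
  let ?N = "laurent_shift f"
  have "int_power a a' k * a ^ ?N = a ^ nat (k + int ?N)" if k: "k \<in> Poly_Mapping.keys f" for k
  proof (cases "k \<ge> 0")
    case True
    then show ?thesis by (simp add: int_power_def nat_add_distrib power_add)
  next
    case False
    have "nat \<bar>k\<bar> \<le> ?N"
      unfolding laurent_shift_def using k by (intro member_le_sum) auto
    then have N: "?N = nat (- k) + nat (k + int ?N)" using False by simp
    have "int_power a a' k * a ^ ?N = a' ^ nat (- k) * (a ^ nat (- k) * a ^ nat (k + int ?N))"
      using False by (subst N) (simp add: int_power_def power_add)
    also have "\<dots> = (a * a') ^ nat (- k) * a ^ nat (k + int ?N)"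
      by (simp add: power_mult_distrib mult_ac)
    finally show ?thesis by (simp add: inv)
  qed
  then show ?thesis
    by (simp add: eval_laurent_def laurent_poly_def ipoly_sum ipoly_monom sum_distrib_right mult.assoc)
qed

lemma unit_power_cancel:
  fixes a a' :: "'r::comm_ring_1"
  assumes "a * a' = 1"
  shows "x * a ^ n = 0 \<longleftrightarrow> x = 0"
proof
  assume "x * a ^ n = 0"
  then have "x * (a ^ n * a' ^ n) = 0" by (simp add: mult.assoc[symmetric])
  then show "x = 0" using assms by (simp flip: power_mult_distrib)
qed simp

lemma eval_laurent_unit:
  fixes a a' :: "'r::comm_ring_1"
  assumes "a * a' = 1" "\<exists>u. u * ipoly (laurent_poly f) a = 1"
  shows "\<exists>u. u * eval_laurent a a' f = 1"
proof -
  obtain u where "u * (eval_laurent a a' f * a ^ laurent_shift f) = 1"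
    using assms eval_laurent_poly by metis
  then have "(u * a ^ laurent_shift f) * eval_laurent a a' f = 1" by (simp add: mult_ac)
  then show ?thesis ..
qed

text \<open>The geometric series for the inverse stops after the linear term.\<close>

lemma nilpotent_unit:
  fixes s :: "'r::comm_ring_1"
  assumes "s * s = 0" "\<exists>u. u * c = 1"
  shows "\<exists>u. u * (c + s * g) = 1"
proof -
  obtain u where u: "u * c = 1" using assms(2) by blast
  have "(u - s * g * u * u) * (c + s * g) = u * c + s * (g * u) * (1 - u * c) - s * s * (g * g * u * u)"
    by (simp add: algebra_simps)
  then show ?thesis using u assms(1) by (intro exI[of _ "u - s * g * u * u"]) simp
qed

text \<open>The bound \<open>Suc i < n\<close> provides a coordinate behind \<open>i\<close>. The
  solution has the values 1 and 0 at these two places, which a nonzero \<open>e\<close> tells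
  apart.\<close>

lemma nontrivial_kernelI:
  fixes e :: "'r::comm_ring_1"
  assumes "upper_triangular B" "B \<in> carrier_mat n n" "Suc i < n"
    and "eval_laurent a a' (B $$ (i, i)) = 0"
    and "\<And>l. l < i \<Longrightarrow> \<exists>u. u * eval_laurent a a' (B $$ (l, l)) = 1"
    and "e \<noteq> 0"
  shows "nontrivial_kernel a a' e B"
proof -
  have "i < n" using assms(3) by simp
  then obtain X where X: "in_kernel a a' B X" "X i = 1" "\<And>j. i < j \<Longrightarrow> X j = 0"
    using triangular_kernel_exists[OF assms(1,2) _ assms(4,5)] by blast
  then have "e * X i \<noteq> e * X (Suc i)" using assms(6) by simp
  then show ?thesis
    unfolding nontrivial_kernel_def using X(1) assms(2,3) by (intro exI[of _ X] conjI exI[of _ i] exI[of _ "Suc i"]) auto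
qed

text \<open>
  The ring of \<open>s\<close> plays the role of the dual numbers over the field with \<open>p\<close> elements, and the ring of
  \<open>e\<close> that of the integers modulo \<open>p^k\<close>.
\<close>

lemma not_triangularizable_criterion:
  fixes p :: int and s :: "'s::comm_ring_1" and e :: "'z::comm_ring_1"
  assumes p: "prime p" and wf: "well_formed D"
    and f0: "of_int p = (0::'f::comm_ring_1)"
    and f_col: "nontrivially_colourable (-1::'f) (-1) 1 D"
    and s0: "of_int p = (0::'s)" "s * s = 0" "s \<noteq> 0"
    and s_col: "\<not> nontrivially_colourable (-1 + s) (-1 - s) s D"
    and z0: "of_int (p ^ k) = (0::'z)" "k \<ge> 1" "e \<noteq> 0"
    and z_col: "\<And>x a'. [x = -1] (mod p) \<Longrightarrow> of_int x * a' = 1 \<Longrightarrow>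
      \<not> nontrivially_colourable (of_int x) a' e D"
  shows "\<not> triangularizable (colouring_matrix D)"
proof
  assume "triangularizable (colouring_matrix D)"
  then obtain B where equiv: "matrix_equivalent (colouring_matrix D) B" and tri: "upper_triangular B"
    unfolding triangularizable_def by (elim exE conjE)
  define n where "n = length (under_passages D)"
  have B: "B \<in> carrier_mat n n"
    using matrix_equivalent_dim[OF equiv] colouring_matrix_carrier[OF wf]
    by (intro carrier_matI) (simp_all add: n_def)
  have sums: "zero_row_sums B"
    using matrix_equivalent_row_sums[OF equiv zero_row_sums_colouring_matrix[OF wf]] .
  let ?d = "\<lambda>i. B $$ (i, i)"
  have coprime: "coprime c p" if "\<not> p dvd c" for c
    using prime_imp_coprime[OF p that] by (simp add: coprime_commute)
  \<comment> \<open>Otherwise all diagonal entries but the last would become units in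
    \<open>'f\<close>, leaving only constant solutions, contrary to \<open>f_col\<close>.\<close>
  have "\<exists>i. Suc i < n \<and> p dvd eval_laurent (-1) (-1) (?d i)"
  proof (rule ccontr)
    assume none: "\<nexists>i. Suc i < n \<and> p dvd eval_laurent (-1) (-1) (?d i)"
    have "\<exists>u. u * eval_laurent (-1) (-1) (?d i) = (1::'f)" if "Suc i < n" for i
    proof -
      have "coprime (eval_laurent (-1) (-1) (?d i)) p" using none that coprime by blast
      from of_int_unit[OF f0 this] show ?thesis by (simp add: of_int_eval_laurent)
    qed
    then have const: "X i = X (n - 1)" if "in_kernel (-1::'f) (-1) B X" "i < n" for X i
      using triangular_kernel_trivial[OF tri B sums _ that] by blast
    have "\<not> nontrivial_kernel (-1::'f) (-1) 1 B"
      unfolding nontrivial_kernel_def using const B by (metis carrier_matD(2))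
    moreover have "(-1::'f) * (-1) = 1" by simp
    ultimately show False
      using matrix_equivalent_kernel[OF equiv] f_col kernel_iff_colourable[OF wf] by blast
  qed
  then have ex: "\<exists>i. Suc i < n \<and> p dvd eval_laurent (-1) (-1) (?d i)" .
  \<comment> \<open>With the first such index, the earlier diagonal entries have values at -1 prime
    to \<open>p\<close>; this makes them units in both local rings.\<close>
  define i where "i = (LEAST i. Suc i < n \<and> p dvd eval_laurent (-1) (-1) (?d i))"
  have i: "Suc i < n" "p dvd eval_laurent (-1) (-1) (?d i)"
    using LeastI_ex[OF ex] by (simp_all add: i_def)
  have least: "\<not> p dvd eval_laurent (-1) (-1) (?d l)" if "l < i" for l
    using not_less_Least[of l "\<lambda>i. Suc i < n \<and> p dvd eval_laurent (-1) (-1) (?d i)"] that i(1)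
    by (simp add: i_def)
  let ?f = "\<lambda>i. laurent_poly (?d i)"
  have poly_dvd: "p dvd poly (?f l) (-1) \<longleftrightarrow> p dvd eval_laurent (-1) (-1) (?d l)" for l
  proof -
    have "poly (?f l) (-1) = eval_laurent (-1) (-1) (?d l) * (-1) ^ laurent_shift (?d l)"
      using eval_laurent_poly[of "-1::int" "-1" "?d l"] ipoly_of_int[of "?f l" "-1", where 'a = int] by simp
    then show ?thesis by (cases "even (laurent_shift (?d l))") simp_all
  qed
  show False
  \<comment> \<open>If the derivative vanishes modulo \<open>p\<close>, then \<open>-1 + s\<close>
    is a root by the Taylor formula; otherwise Hensel's lemma supplies an integer that is a root
    modulo \<open>p^k\<close>.\<close>
  proof (cases "p dvd poly (pderiv (?f i)) (-1)")
    case True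
    have inv: "(-1 + s) * (-1 - s) = 1" using s0(2) by (simp add: algebra_simps)
    have eval: "ipoly (?f l) (-1 + s) = of_int (poly (?f l) (-1)) + s * of_int (poly (pderiv (?f l)) (-1))" for l
      using ipoly_nilpotent[OF s0(2), of "?f l" "-1"] by simp
    have zero: "of_int c = (0::'s)" if "p dvd c" for c
      using that s0(1) by (auto elim!: dvdE)
    have "eval_laurent (-1 + s) (-1 - s) (?d i) = 0"
    proof -
      have "ipoly (?f i) (-1 + s) = 0"
        unfolding eval using i(2) True by (simp add: zero poly_dvd)
      then show ?thesis
        unfolding eval_laurent_poly[OF inv, symmetric] unit_power_cancel[OF inv] .
    qed
    moreover have "\<exists>u. u * eval_laurent (-1 + s) (-1 - s) (?d l) = 1" if "l < i" for l
    proof (rule eval_laurent_unit[OF inv])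
      show "\<exists>u. u * ipoly (?f l) (-1 + s) = 1"
        unfolding eval using least[OF that] poly_dvd coprime
        by (intro nilpotent_unit s0(2) of_int_unit[OF s0(1)]) blast
    qed
    ultimately have "nontrivial_kernel (-1 + s) (-1 - s) s B"
      using nontrivial_kernelI[OF tri B i(1)] s0(3) by blast
    then show False
      using s_col matrix_equivalent_kernel[OF equiv inv] kernel_iff_colourable[OF wf] by blast
  next
    case False
    then obtain x where x: "[x = -1] (mod p)" "p ^ k dvd poly (?f i) x"
      using hensel[OF p _ False z0(2)] poly_dvd i(2) by blast
    have "\<not> p dvd x"
      using x(1) p by (metis cong_dvd_iff dvd_minus_iff not_prime_unit)
    then obtain u where "u * of_int x = (1::'z)"
      using of_int_unit[OF z0(1), of x] coprime by auto
    then have inv: "of_int x * u = (1::'z)" by (simp add: mult.commute)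
    have "of_int (poly (?f i) x) = (0::'z)"
      using x(2) z0(1) by (metis dvdE mult_zero_left of_int_mult)
    then have "eval_laurent (of_int x) u (?d i) = 0"
      using eval_laurent_poly[OF inv, of "?d i"] by (simp add: ipoly_of_int unit_power_cancel[OF inv])
    moreover have "\<exists>v. v * eval_laurent (of_int x) u (?d l) = 1" if "l < i" for l
    proof (rule eval_laurent_unit[OF inv])
      have "\<not> p dvd poly (?f l) x"
        using least[OF that] poly_dvd cong_dvd_iff[OF poly_cong[OF x(1)]] by blast
      then have "coprime (poly (?f l) x) (p ^ k)" using coprime by simp
      then show "\<exists>v. v * ipoly (?f l) (of_int x) = (1::'z)"
        unfolding ipoly_of_int using of_int_unit[OF z0(1)] by blast
    qed
    ultimately have "nontrivial_kernel (of_int x) u e B"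
      using nontrivial_kernelI[OF tri B i(1)] z0(3) by blast
    then show False
      using z_col[OF x(1) inv] matrix_equivalent_kernel[OF equiv inv] kernel_iff_colourable[OF wf] by blast
  qed
qed

section \<open>The Alexander modules of the five knots\<close>

text \<open>The second equation goes on with \<open>h c\<close> in place of \<open>x\<close>, so
  that unrolling a concrete code gives one short equation for each stretch between upper
  passages.\<close>

lemma runs_iffs:
  "runs a a' h x [] y \<longleftrightarrow> x = y"
  "runs a a' h x ((c, Over, s) # w) y \<longleftrightarrow> x = h c \<and> runs a a' h (h c) w y"
  "runs a a' h x ((c, Under, 1) # w) y \<longleftrightarrow> runs a a' h (quandle_op a x (h c)) w y"
  "runs a a' h x ((c, Under, -1) # w) y \<longleftrightarrow> runs a a' h (quandle_op a' x (h c)) w y"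
  by auto

text \<open>Turns the relation at a negative crossing around so that only \<open>a\<close> occurs,
  which makes all relations polynomial in \<open>a\<close>.\<close>

lemma quandle_op_eq_iff:
  assumes "a * a' = 1"
  shows "quandle_op a' x y = z \<longleftrightarrow> x = quandle_op a z y"
  using quandle_op_cancel[of a a'] quandle_op_cancel[of a' a] assms by (metis mult.commute)

lemma quandle_op_fixed:
  assumes "a * a' = 1"
  shows "quandle_op a x y = y \<longleftrightarrow> x = y" "y = quandle_op a x y \<longleftrightarrow> x = y"
proof -
  have "a' * a = 1" using assms by (simp add: mult.commute)
  then show "quandle_op a x y = y \<longleftrightarrow> x = y" "y = quandle_op a x y \<longleftrightarrow> x = y"
    using quandle_op_cancel[of a' a] quandle_op_idem by metis+
qed

text \<open>
  For each knot, three of the arcs generate all colourings. The coefficients of the linear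
  combinations below come from eliminating the other arcs.
\<close>

lemma knot_9_35_runs:
  assumes "runs a a' h q knot_9_35 q" "a * a' = 1"
  shows "q - h 1 = 0"
    "quandle_op a (h 1) (h 2) - h 3 = 0"
    "quandle_op a (h 3) (h 4) - h 5 = 0"
    "quandle_op a (h 5) (h 6) - h 7 = 0"
    "quandle_op a (h 7) (h 1) - h 8 = 0"
    "quandle_op a (h 8) (h 9) - h 4 = 0"
    "quandle_op a (h 4) (h 3) - h 2 = 0"
    "quandle_op a (h 2) (h 7) - h 6 = 0"
    "quandle_op a (h 6) (h 5) - h 9 = 0"
    "quandle_op a (h 9) (h 8) - q = 0"
  \<comment> \<open>Unrolling the code once gives all equations together; with right-hand side 0
    they are ready for linear combinations.\<close>
  unfolding atomize_conj
  by (rule iffD1[OF _ assms(1)])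
    (simp add: knot_9_35_def signed_code_def runs_iffs quandle_op_eq_iff[OF assms(2)] del: runs.simps)

text \<open>Up to sign, the determinant of these relations is the Alexander polynomial
  \<open>7 - 13 a + 7 a^2\<close>; at \<open>a = -1\<close> all four coefficients are divisible by
  3.\<close>

lemma knot_9_35_relations:
  fixes a a' :: "'r::comm_ring_1"
  assumes "runs a a' h q knot_9_35 q" "a * a' = 1"
  defines "u \<equiv> h 5 - h 4" and "v \<equiv> h 9 - h 4"
  shows "(2 - a) * u + (1 - 2 * a) * v = 0"
    "(1 - 2 * a) * u + (- 3 + 3 * a) * v = 0"
proof -
  have "(2 - a) * u + (1 - 2 * a) * v =
      (- 1) * (quandle_op a (h 1) (h 2) - h 3) +
      (- 2 + a) * (quandle_op a (h 3) (h 4) - h 5) +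
      (1 - a) * (quandle_op a (h 8) (h 9) - h 4) +
      (- 1 + a) * (quandle_op a (h 4) (h 3) - h 2) +
      (- a) * (quandle_op a (h 9) (h 8) - q) +
      (- a) * (q - h 1)"
    unfolding u_def v_def quandle_op_def by (simp add: algebra_simps eval_nat_numeral)
  also have "\<dots> = 0"
    by (simp only: knot_9_35_runs[OF assms(1,2)] mult_zero_right add_0_left)
  finally show "(2 - a) * u + (1 - 2 * a) * v = 0" .
  have "(1 - 2 * a) * u + (- 3 + 3 * a) * v =
      (- a) * (quandle_op a (h 5) (h 6) - h 7) +
      (- 1) * (quandle_op a (h 7) (h 1) - h 8) +
      (- 2 + a) * (quandle_op a (h 8) (h 9) - h 4) +
      (1 - a) * (quandle_op a (h 6) (h 5) - h 9) +
      (- 1 + a) * (quandle_op a (h 9) (h 8) - q) +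
      (- 1 + a) * (q - h 1)"
    unfolding u_def v_def quandle_op_def by (simp add: algebra_simps eval_nat_numeral)
  also have "\<dots> = 0"
    by (simp only: knot_9_35_runs[OF assms(1,2)] mult_zero_right add_0_left)
  finally show "(1 - 2 * a) * u + (- 3 + 3 * a) * v = 0" .
qed

text \<open>By \<open>quandle_op_fixed\<close>, a crossing at which two suitable colours agree has a
  single colour. The crossings are visited in an order in which each new colour follows from those
  collected in \<open>const\<close>.\<close>

lemma knot_9_35_constant:
  assumes "runs a a' h q knot_9_35 q" "a * a' = 1" "h 5 = h 4" "h 9 = h 4"
  shows "constant_mod 1 h q knot_9_35"
proof -
  note fixed = quandle_op_fixed[OF assms(2)]
  note const = assms(3,4)
  have "h 3 = h 4"
    using knot_9_35_runs(3)[OF assms(1,2)] by (simp add: const fixed del: One_nat_def)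
  note const = const this
  have "h 8 = h 4"
    using knot_9_35_runs(6)[OF assms(1,2)] by (simp add: const fixed del: One_nat_def)
  note const = const this
  have "h 2 = h 4"
    using knot_9_35_runs(7)[OF assms(1,2)] by (simp add: const fixed del: One_nat_def)
  note const = const this
  have "h 6 = h 4"
    using knot_9_35_runs(9)[OF assms(1,2)] by (simp add: const fixed del: One_nat_def)
  note const = const this
  have "q = h 4"
    using knot_9_35_runs(10)[OF assms(1,2)] by (simp add: const fixed del: One_nat_def)
  note const = const this
  have "h 1 = h 4"
    using knot_9_35_runs(1)[OF assms(1,2)] by (simp add: const fixed del: One_nat_def)
  note const = const this
  have "h 7 = h 4"
    using knot_9_35_runs(4)[OF assms(1,2)] by (simp add: const fixed del: One_nat_def)
  note const = const this
  show ?thesis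
    using const by (simp add: knot_9_35_def signed_code_def)
qed

section \<open>Relations for the knot 9_47\<close>

lemma knot_9_47_runs:
  assumes "runs a a' h q knot_9_47 q" "a * a' = 1"
  shows "q - h 1 = 0"
    "h 1 - quandle_op a (h 3) (h 2) = 0"
    "quandle_op a (h 3) (h 4) - h 5 = 0"
    "quandle_op a (h 5) (h 1) - h 6 = 0"
    "h 6 - quandle_op a (h 7) (h 3) = 0"
    "quandle_op a (quandle_op a (h 7) (h 5)) (h 8) - h 9 = 0"
    "h 9 - h 4 = 0"
    "h 4 - quandle_op a (h 2) (h 7) = 0"
    "quandle_op a (quandle_op a (h 2) (h 6)) (h 9) - h 8 = 0"
    "h 8 - q = 0"
  unfolding atomize_conj
  by (rule iffD1[OF _ assms(1)])
    (simp add: knot_9_47_def signed_code_def runs_iffs quandle_op_eq_iff[OF assms(2)] del: runs.simps)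

text \<open>The determinant is the Alexander polynomial
  \<open>1 - 4 a + 6 a^2 - 5 a^3 + 6 a^4 - 4 a^5 + a^6\<close>; at -1 the coefficients are 3, -6, 3,
  3.\<close>

lemma knot_9_47_relations:
  fixes a a' :: "'r::comm_ring_1"
  assumes "runs a a' h q knot_9_47 q" "a * a' = 1"
  defines "u \<equiv> h 3 - h 7" and "v \<equiv> h 2 - h 7"
  shows "(1 - 2 * a) * u + (- 1 + 2 * a - 2 * a^2 + a^3) * v = 0"
    "(2 * a^2 - a^3) * u + (1 - 2 * a) * v = 0"
proof -
  have "(1 - 2 * a) * u + (- 1 + 2 * a - 2 * a^2 + a^3) * v =
      (1 - a) * (h 1 - quandle_op a (h 3) (h 2)) +
      (- a) * (quandle_op a (h 3) (h 4) - h 5) +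
      (- 1) * (quandle_op a (h 5) (h 1) - h 6) +
      (- 1) * (h 6 - quandle_op a (h 7) (h 3)) +
      (a - a^2) * (h 4 - quandle_op a (h 2) (h 7))"
    unfolding u_def v_def quandle_op_def by (simp add: algebra_simps eval_nat_numeral)
  also have "\<dots> = 0"
    by (simp only: knot_9_47_runs[OF assms(1,2)] mult_zero_right add_0_left)
  finally show "(1 - 2 * a) * u + (- 1 + 2 * a - 2 * a^2 + a^3) * v = 0" .
  have "(2 * a^2 - a^3) * u + (1 - 2 * a) * v =
      (- 1) * (h 1 - quandle_op a (h 3) (h 2)) +
      (a - a^2) * (h 6 - quandle_op a (h 7) (h 3)) +
      (1 - a) * (h 4 - quandle_op a (h 2) (h 7)) +
      (- 1) * (quandle_op a (quandle_op a (h 2) (h 6)) (h 9) - h 8) +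
      (- 1) * (h 8 - q) +
      (- 1) * (q - h 1) +
      (1 - a) * (h 9 - h 4)"
    unfolding u_def v_def quandle_op_def by (simp add: algebra_simps eval_nat_numeral)
  also have "\<dots> = 0"
    by (simp only: knot_9_47_runs[OF assms(1,2)] mult_zero_right add_0_left)
  finally show "(2 * a^2 - a^3) * u + (1 - 2 * a) * v = 0" .
qed

lemma knot_9_47_constant:
  assumes "runs a a' h q knot_9_47 q" "a * a' = 1" "h 3 = h 7" "h 2 = h 7"
  shows "constant_mod 1 h q knot_9_47"
proof -
  note fixed = quandle_op_fixed[OF assms(2)]
  note const = assms(3,4)
  have "h 1 = h 7"
    using knot_9_47_runs(2)[OF assms(1,2)] by (simp add: const fixed del: One_nat_def)
  note const = const this
  have "h 6 = h 7"
    using knot_9_47_runs(5)[OF assms(1,2)] by (simp add: const fixed del: One_nat_def)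
  note const = const this
  have "h 4 = h 7"
    using knot_9_47_runs(8)[OF assms(1,2)] by (simp add: const fixed del: One_nat_def)
  note const = const this
  have "q = h 7"
    using knot_9_47_runs(1)[OF assms(1,2)] by (simp add: const fixed del: One_nat_def)
  note const = const this
  have "h 5 = h 7"
    using knot_9_47_runs(3)[OF assms(1,2)] by (simp add: const fixed del: One_nat_def)
  note const = const this
  have "h 9 = h 7"
    using knot_9_47_runs(7)[OF assms(1,2)] by (simp add: const fixed del: One_nat_def)
  note const = const this
  have "h 8 = h 7"
    using knot_9_47_runs(9)[OF assms(1,2)] by (simp add: const fixed del: One_nat_def)
  note const = const this
  show ?thesis
    using const by (simp add: knot_9_47_def signed_code_def)
qed

section \<open>Relations for the knot 9_48\<close>

lemma knot_9_48_runs: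
  assumes "runs a a' h q knot_9_48 q" "a * a' = 1"
  shows "q - h 1 = 0"
    "h 1 - quandle_op a (h 3) (h 2) = 0"
    "quandle_op a (h 3) (h 1) - quandle_op a (h 5) (h 4) = 0"
    "h 5 - quandle_op a (quandle_op a (h 8) (h 7)) (h 6) = 0"
    "h 8 - quandle_op a (h 2) (h 3) = 0"
    "h 2 - h 6 = 0"
    "h 6 - quandle_op a (h 4) (h 5) = 0"
    "h 4 - h 9 = 0"
    "h 9 - quandle_op a (h 7) (h 8) = 0"
    "quandle_op a (h 7) (h 9) - q = 0"
  unfolding atomize_conj
  by (rule iffD1[OF _ assms(1)])
    (simp add: knot_9_48_def signed_code_def runs_iffs quandle_op_eq_iff[OF assms(2)] del: runs.simps)

text \<open>The determinant is minus the Alexander polynomial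
  \<open>1 - 7 a + 11 a^2 - 7 a^3 + a^4\<close>; at -1 the coefficients are -3, 0, -3, 9.\<close>

lemma knot_9_48_relations:
  fixes a a' :: "'r::comm_ring_1"
  assumes "runs a a' h q knot_9_48 q" "a * a' = 1"
  defines "u \<equiv> h 5 - h 1" and "v \<equiv> h 2 - h 1"
  shows "(- 1 + 2 * a) * u + (1 - a^2) * v = 0"
    "(- 1 + a - a^2) * u + (2 - 4 * a + 3 * a^2) * v = 0"
proof -
  have "(- 1 + 2 * a) * u + (1 - a^2) * v =
      (- a) * (h 1 - quandle_op a (h 3) (h 2)) +
      (- a) * (quandle_op a (h 3) (h 1) - quandle_op a (h 5) (h 4)) +
      (1 - a) * (h 6 - quandle_op a (h 4) (h 5)) +
      (1 - a) * (h 2 - h 6)"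
    unfolding u_def v_def quandle_op_def by (simp add: algebra_simps eval_nat_numeral)
  also have "\<dots> = 0"
    by (simp only: knot_9_48_runs[OF assms(1,2)] mult_zero_right add_0_left)
  finally show "(- 1 + 2 * a) * u + (1 - a^2) * v = 0" .
  have "(- 1 + a - a^2) * u + (2 - 4 * a + 3 * a^2) * v =
      (- 1 + 3 * a - 2 * a^2) * (h 1 - quandle_op a (h 3) (h 2)) +
      (- a) * (h 5 - quandle_op a (quandle_op a (h 8) (h 7)) (h 6)) +
      (a - 2 * a^2) * (h 8 - quandle_op a (h 2) (h 3)) +
      (1 - a) * (h 6 - quandle_op a (h 4) (h 5)) +
      (a - a^2) * (h 9 - quandle_op a (h 7) (h 8)) +
      (a - a^2) * (h 4 - h 9) +
      (1 - a^2) * (h 2 - h 6)"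
    unfolding u_def v_def quandle_op_def by (simp add: algebra_simps eval_nat_numeral)
  also have "\<dots> = 0"
    by (simp only: knot_9_48_runs[OF assms(1,2)] mult_zero_right add_0_left)
  finally show "(- 1 + a - a^2) * u + (2 - 4 * a + 3 * a^2) * v = 0" .
qed

lemma knot_9_48_constant:
  assumes "runs a a' h q knot_9_48 q" "a * a' = 1" "h 5 = h 1" "h 2 = h 1"
  shows "constant_mod 1 h q knot_9_48"
proof -
  note fixed = quandle_op_fixed[OF assms(2)]
  note const = assms(3,4)
  have "q = h 1"
    using knot_9_48_runs(1)[OF assms(1,2)] by (simp add: const fixed del: One_nat_def)
  note const = const this
  have "h 3 = h 1"
    using knot_9_48_runs(2)[OF assms(1,2)] by (simp add: const fixed del: One_nat_def)
  note const = const this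
  have "h 8 = h 1"
    using knot_9_48_runs(5)[OF assms(1,2)] by (simp add: const fixed del: One_nat_def)
  note const = const this
  have "h 6 = h 1"
    using knot_9_48_runs(6)[OF assms(1,2)] by (simp add: const fixed del: One_nat_def)
  note const = const this
  have "h 4 = h 1"
    using knot_9_48_runs(7)[OF assms(1,2)] by (simp add: const fixed del: One_nat_def)
  note const = const this
  have "h 9 = h 1"
    using knot_9_48_runs(8)[OF assms(1,2)] by (simp add: const fixed del: One_nat_def)
  note const = const this
  have "h 7 = h 1"
    using knot_9_48_runs(9)[OF assms(1,2)] by (simp add: const fixed del: One_nat_def)
  note const = const this
  show ?thesis
    using const by (simp add: knot_9_48_def signed_code_def)
qed

section \<open>Relations for the knot 9_49\<close>

lemma knot_9_49_runs:
  assumes "runs a a' h q knot_9_49 q" "a * a' = 1"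
  shows "q - h 1 = 0"
    "h 1 - h 2 = 0"
    "quandle_op a (h 2) (h 3) - h 4 = 0"
    "quandle_op a (quandle_op a (h 4) (h 5)) (h 1) - h 6 = 0"
    "h 6 - h 7 = 0"
    "quandle_op a (h 7) (h 8) - h 3 = 0"
    "quandle_op a (quandle_op a (h 3) (h 2)) (h 6) - h 9 = 0"
    "h 9 - h 5 = 0"
    "quandle_op a (h 5) (h 4) - h 8 = 0"
    "quandle_op a (quandle_op a (h 8) (h 7)) (h 9) - q = 0"
  unfolding atomize_conj
  by (rule iffD1[OF _ assms(1)])
    (simp add: knot_9_49_def signed_code_def runs_iffs quandle_op_eq_iff[OF assms(2)] del: runs.simps)

text \<open>The determinant is minus the Alexander polynomial
  \<open>3 - 6 a + 7 a^2 - 6 a^3 + 3 a^4\<close>; at -1 the coefficients are 5, 0, 0, -5.\<close>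

lemma knot_9_49_relations:
  fixes a a' :: "'r::comm_ring_1"
  assumes "runs a a' h q knot_9_49 q" "a * a' = 1"
  defines "u \<equiv> h 6 - h 1" and "v \<equiv> h 9 - h 1"
  shows "(2 - 2 * a + a^2) * u + (- 1 + a^2) * v = 0"
    "(- 1 + a^2) * u + (- 1 + 2 * a - 2 * a^2) * v = 0"
proof -
  have "(2 - 2 * a + a^2) * u + (- 1 + a^2) * v =
      (- (a^2)) * (quandle_op a (h 2) (h 3) - h 4) +
      (- 1) * (quandle_op a (quandle_op a (h 4) (h 5)) (h 1) - h 6) +
      (1 - a) * (quandle_op a (quandle_op a (h 3) (h 2)) (h 6) - h 9) +
      (- a + a^2) * (h 9 - h 5) +
      (a - 2 * a^2) * (h 1 - h 2)"
    unfolding u_def v_def quandle_op_def by (simp add: algebra_simps eval_nat_numeral)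
  also have "\<dots> = 0"
    by (simp only: knot_9_49_runs[OF assms(1,2)] mult_zero_right add_0_left)
  finally show "(2 - 2 * a + a^2) * u + (- 1 + a^2) * v = 0" .
  have "(- 1 + a^2) * u + (- 1 + 2 * a - 2 * a^2) * v =
      (1 - a) * (quandle_op a (quandle_op a (h 4) (h 5)) (h 1) - h 6) +
      (- (a^2)) * (quandle_op a (h 5) (h 4) - h 8) +
      (- 1) * (quandle_op a (quandle_op a (h 8) (h 7)) (h 9) - q) +
      (- 1) * (q - h 1) +
      (a - 2 * a^2) * (h 9 - h 5) +
      (- a + a^2) * (h 6 - h 7)"
    unfolding u_def v_def quandle_op_def by (simp add: algebra_simps eval_nat_numeral)
  also have "\<dots> = 0"
    by (simp only: knot_9_49_runs[OF assms(1,2)] mult_zero_right add_0_left)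
  finally show "(- 1 + a^2) * u + (- 1 + 2 * a - 2 * a^2) * v = 0" .
qed

lemma knot_9_49_constant:
  assumes "runs a a' h q knot_9_49 q" "a * a' = 1" "h 6 = h 1" "h 9 = h 1"
  shows "constant_mod 1 h q knot_9_49"
proof -
  note fixed = quandle_op_fixed[OF assms(2)]
  note const = assms(3,4)
  have "q = h 1"
    using knot_9_49_runs(1)[OF assms(1,2)] by (simp add: const fixed del: One_nat_def)
  note const = const this
  have "h 2 = h 1"
    using knot_9_49_runs(2)[OF assms(1,2)] by (simp add: const fixed del: One_nat_def)
  note const = const this
  have "h 7 = h 1"
    using knot_9_49_runs(5)[OF assms(1,2)] by (simp add: const fixed del: One_nat_def)
  note const = const this
  have "h 3 = h 1"
    using knot_9_49_runs(7)[OF assms(1,2)] by (simp add: const fixed del: One_nat_def)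
  note const = const this
  have "h 5 = h 1"
    using knot_9_49_runs(8)[OF assms(1,2)] by (simp add: const fixed del: One_nat_def)
  note const = const this
  have "h 8 = h 1"
    using knot_9_49_runs(10)[OF assms(1,2)] by (simp add: const fixed del: One_nat_def)
  note const = const this
  have "h 4 = h 1"
    using knot_9_49_runs(3)[OF assms(1,2)] by (simp add: const fixed del: One_nat_def)
  note const = const this
  show ?thesis
    using const by (simp add: knot_9_49_def signed_code_def)
qed

section \<open>Relations for the knot 10_157\<close>

lemma knot_10_157_runs:
  assumes "runs a a' h q knot_10_157 q" "a * a' = 1"
  shows "q - h 1 = 0"
    "quandle_op a (h 1) (h 2) - h 3 = 0"
    "h 3 - h 4 = 0"
    "quandle_op a (h 4) (h 5) - h 6 = 0"
    "h 6 - quandle_op a (h 8) (h 7) = 0"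
    "quandle_op a (quandle_op a (h 8) (h 9)) (h 1) - h 2 = 0"
    "quandle_op a (h 2) (h 3) - quandle_op a (h 10) (h 6) = 0"
    "quandle_op a (h 10) (h 8) - h 9 = 0"
    "quandle_op a (h 9) (h 4) - h 5 = 0"
    "quandle_op a (h 5) (h 10) - h 7 = 0"
    "h 7 - q = 0"
  unfolding atomize_conj
  by (rule iffD1[OF _ assms(1)])
    (simp add: knot_10_157_def signed_code_def runs_iffs quandle_op_eq_iff[OF assms(2)] del: runs.simps)

text \<open>The determinant is the Alexander polynomial
  \<open>1 - 6 a + 11 a^2 - 13 a^3 + 11 a^4 - 6 a^5 + a^6\<close>; at -1 the coefficients are 0, 7,
  -7, 7.\<close>

lemma knot_10_157_relations:
  fixes a a' :: "'r::comm_ring_1"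
  assumes "runs a a' h q knot_10_157 q" "a * a' = 1"
  defines "u \<equiv> h 2 - h 3" and "v \<equiv> h 5 - h 3"
  shows "(- 1 + a^2) * u + (1 - 3 * a + 2 * a^2 - a^3) * v = 0"
    "(- 1 + 3 * a - 3 * a^2) * u + (3 * a^2 - 3 * a^3 + a^4) * v = 0"
proof -
  have "(- 1 + a^2) * u + (1 - 3 * a + 2 * a^2 - a^3) * v =
      (- 1) * (quandle_op a (h 1) (h 2) - h 3) +
      (1 - 2 * a + a^2) * (quandle_op a (h 4) (h 5) - h 6) +
      (- 1 + a) * (quandle_op a (h 2) (h 3) - quandle_op a (h 10) (h 6)) +
      (- a) * (quandle_op a (h 5) (h 10) - h 7) +
      (- a) * (h 7 - q) +
      (- a) * (q - h 1) +
      (a - 2 * a^2 + a^3) * (h 3 - h 4)"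
    unfolding u_def v_def quandle_op_def by (simp add: algebra_simps eval_nat_numeral)
  also have "\<dots> = 0"
    by (simp only: knot_10_157_runs[OF assms(1,2)] mult_zero_right add_0_left)
  finally show "(- 1 + a^2) * u + (1 - 3 * a + 2 * a^2 - a^3) * v = 0" .
  have "(- 1 + 3 * a - 3 * a^2) * u + (3 * a^2 - 3 * a^3 + a^4) * v =
      (- 1 + 2 * a - a^2) * (quandle_op a (h 1) (h 2) - h 3) +
      (- a + 2 * a^2 - a^3) * (quandle_op a (h 4) (h 5) - h 6) +
      (- a + a^2) * (h 6 - quandle_op a (h 8) (h 7)) +
      (- (a^2)) * (quandle_op a (h 2) (h 3) - quandle_op a (h 10) (h 6)) +
      (- (a^2)) * (quandle_op a (h 10) (h 8) - h 9) +
      (- a) * (quandle_op a (h 9) (h 4) - h 5) +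
      (- a + 2 * a^2 - a^3) * (h 7 - q) +
      (- a + 2 * a^2 - a^3) * (q - h 1) +
      (- a + 2 * a^3 - a^4) * (h 3 - h 4)"
    unfolding u_def v_def quandle_op_def by (simp add: algebra_simps eval_nat_numeral)
  also have "\<dots> = 0"
    by (simp only: knot_10_157_runs[OF assms(1,2)] mult_zero_right add_0_left)
  finally show "(- 1 + 3 * a - 3 * a^2) * u + (3 * a^2 - 3 * a^3 + a^4) * v = 0" .
qed

lemma knot_10_157_constant:
  assumes "runs a a' h q knot_10_157 q" "a * a' = 1" "h 2 = h 3" "h 5 = h 3"
  shows "constant_mod 1 h q knot_10_157"
proof -
  note fixed = quandle_op_fixed[OF assms(2)]
  note const = assms(3,4)
  have "h 1 = h 3"
    using knot_10_157_runs(2)[OF assms(1,2)] by (simp add: const fixed del: One_nat_def)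
  note const = const this
  have "h 4 = h 3"
    using knot_10_157_runs(3)[OF assms(1,2)] by (simp add: const fixed del: One_nat_def)
  note const = const this
  have "h 6 = h 3"
    using knot_10_157_runs(4)[OF assms(1,2)] by (simp add: const fixed del: One_nat_def)
  note const = const this
  have "h 10 = h 3"
    using knot_10_157_runs(7)[OF assms(1,2)] by (simp add: const fixed del: One_nat_def)
  note const = const this
  have "h 9 = h 3"
    using knot_10_157_runs(9)[OF assms(1,2)] by (simp add: const fixed del: One_nat_def)
  note const = const this
  have "h 7 = h 3"
    using knot_10_157_runs(10)[OF assms(1,2)] by (simp add: const fixed del: One_nat_def)
  note const = const this
  have "q = h 3"
    using knot_10_157_runs(11)[OF assms(1,2)] by (simp add: const fixed del: One_nat_def)
  note const = const this
  have "h 8 = h 3"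
    using knot_10_157_runs(5)[OF assms(1,2)] by (simp add: const fixed del: One_nat_def)
  note const = const this
  show ?thesis
    using const by (simp add: knot_10_157_def signed_code_def)
qed

section \<open>Excluding colourings over local rings\<close>

datatype 'a dual = Dual (re_part: 'a) (eps_part: 'a)

instantiation dual :: (comm_ring_1) comm_ring_1
begin

definition "0 = Dual 0 0"
definition "1 = Dual 1 0"
definition "x + y = Dual (re_part x + re_part y) (eps_part x + eps_part y)"
definition "x - y = Dual (re_part x - re_part y) (eps_part x - eps_part y)"
definition "- x = Dual (- re_part x) (- eps_part x)"
definition "x * y = Dual (re_part x * re_part y) (re_part x * eps_part y + eps_part x * re_part y)"

instance
  by standard
    (auto simp: zero_dual_def one_dual_def plus_dual_def minus_dual_def uminus_dual_def times_dual_def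
      algebra_simps intro: dual.expand)

end

lemma of_nat_dual: "of_nat n = Dual (of_nat n) 0"
  by (induction n) (simp_all add: zero_dual_def one_dual_def plus_dual_def)

lemma of_int_dual: "of_int n = Dual (of_int n) 0"
  by (cases n) (simp_all add: of_nat_dual one_dual_def minus_dual_def uminus_dual_def)

lemma eps_square: "Dual 0 1 * Dual 0 1 = (0 :: 'a::comm_ring_1 dual)"
  by (simp add: times_dual_def zero_dual_def)

text \<open>The relations are linear. Scaling a colouring by \<open>e\<close> turns constancy modulo
  the annihilator of \<open>e\<close> into plain constancy.\<close>

lemma runs_scale:
  assumes "runs a a' h x w y"
  shows "runs a a' (\<lambda>c. e * h c) (e * x) w (e * y)"
proof -
  have op: "e * quandle_op t x y = quandle_op t (e * x) (e * y)" for t x y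
    by (simp add: quandle_op_def algebra_simps)
  from assms show ?thesis
    by (induction a a' h x w y rule: runs.induct) (auto simp: op)
qed

lemma of_int_gcd_annihilates:
  fixes x :: "'r::comm_ring_1"
  assumes "of_int c * x = 0" "of_int n * x = 0" "gcd c n dvd g"
  shows "of_int g * x = 0"
proof -
  obtain u v where uv: "u * c + v * n = gcd c n" using bezout_int by blast
  obtain t where "g = gcd c n * t" using assms(3) by (elim dvdE)
  then have "g = (u * c + v * n) * t" by (simp only: uv)
  then have "of_int g * x = of_int (t * u) * (of_int c * x) + of_int (t * v) * (of_int n * x)"
    by (simp add: algebra_simps)
  then show ?thesis by (simp add: assms)
qed

text \<open>The gcd is a power of \<open>p\<close>, and the exponent \<open>Suc j\<close> is
  excluded.\<close>

lemma gcd_prime_power_dvd: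
  fixes p d :: int
  assumes "prime p" "\<not> p ^ Suc j dvd d"
  shows "gcd d (p ^ Suc j) dvd p ^ j"
proof -
  obtain i where i: "i \<le> Suc j" "gcd d (p ^ Suc j) = p ^ i"
    using divides_primepow[OF assms(1), of "gcd d (p ^ Suc j)" "Suc j"] assms(1)
    by (auto simp: normalize_power prime_ge_0_int)
  then have "i \<noteq> Suc j" using assms(2) by (metis gcd_dvd1)
  then show ?thesis using i by (simp add: le_imp_power_dvd)
qed

text \<open>Two generators of the Alexander module are the differences of the colours at
  \<open>i\<close> and \<open>j\<close> from that at \<open>o1\<close>. The first two clauses are
  relations between them; the last one says that they generate.\<close>

definition two_generator_relations ::
    "'r::comm_ring_1 \<Rightarrow> 'r \<Rightarrow> gauss_code \<Rightarrow> nat \<times> nat \<times> nat \<Rightarrow> 'r \<times> 'r \<times> 'r \<times> 'r \<Rightarrow> bool" where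
  "two_generator_relations a a' w = (\<lambda>(o1, i, j) (c11, c12, c21, c22). \<forall>h q. runs a a' h q w q \<longrightarrow>
     c11 * (h i - h o1) + c12 * (h j - h o1) = 0 \<and>
     c21 * (h i - h o1) + c22 * (h j - h o1) = 0 \<and>
     (h i = h o1 \<longrightarrow> h j = h o1 \<longrightarrow> constant_mod 1 h q w))"

text \<open>With \<pi> factored out of the relations, Cramer's rule annihilates \<pi> times each
  generator by the remaining determinant. It is also annihilated by \<open>p^(n+1)\<close>, hence by
  \<open>p^n\<close>. The two uses are \<pi> = \<open>s\<close> with \<open>n = 0\<close> and \<pi>
  = \<open>p\<close>.\<close>

lemma not_colourable_by_cramer:
  fixes a a' \<pi> :: "'r::comm_ring_1" and p :: int
  assumes rel: "two_generator_relations a a' w (o1, i, j) (c11, c12, c21, c22)"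
    and c: "c11 = \<pi> * of_int k11" "c12 = \<pi> * of_int k12" "c21 = \<pi> * of_int k21" "c22 = \<pi> * of_int k22"
    and p: "prime p" "of_int (p ^ Suc n) * \<pi> = 0"
    and det: "\<not> p ^ Suc n dvd k11 * k22 - k12 * k21"
  shows "\<not> nontrivially_colourable a a' (of_int (p ^ n) * \<pi>) w"
proof
  let ?e = "of_int (p ^ n) * \<pi>"
  assume "nontrivially_colourable a a' ?e w"
  then obtain h q where runs: "runs a a' h q w q" and "\<not> constant_mod ?e h q w"
    unfolding nontrivially_colourable_def by blast
  then have nonconst: "\<not> constant_mod 1 (\<lambda>c. ?e * h c) (?e * q) w"
    by (simp add: constant_mod_def)
  define u where "u = h i - h o1"
  define v where "v = h j - h o1"
  have r: "\<pi> * of_int k11 * u + \<pi> * of_int k12 * v = 0" "\<pi> * of_int k21 * u + \<pi> * of_int k22 * v = 0"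
    using rel runs unfolding two_generator_relations_def by (auto simp: c u_def v_def)
  have "of_int (k11 * k22 - k12 * k21) * (\<pi> * u) =
      of_int k22 * (\<pi> * of_int k11 * u + \<pi> * of_int k12 * v)
      - of_int k12 * (\<pi> * of_int k21 * u + \<pi> * of_int k22 * v)"
    by (simp add: algebra_simps)
  then have u: "of_int (k11 * k22 - k12 * k21) * (\<pi> * u) = 0" by (simp only: r) simp
  have "of_int (k11 * k22 - k12 * k21) * (\<pi> * v) =
      of_int k11 * (\<pi> * of_int k21 * u + \<pi> * of_int k22 * v)
      - of_int k21 * (\<pi> * of_int k11 * u + \<pi> * of_int k12 * v)"
    by (simp add: algebra_simps)
  then have v: "of_int (k11 * k22 - k12 * k21) * (\<pi> * v) = 0" by (simp only: r) simp
  have kill: "of_int (p ^ Suc n) * (\<pi> * x) = 0" for x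
    using p(2) by (metis mult.assoc mult_zero_left)
  have "?e * u = 0" "?e * v = 0"
    using of_int_gcd_annihilates[OF u kill gcd_prime_power_dvd[OF p(1) det]]
      of_int_gcd_annihilates[OF v kill gcd_prime_power_dvd[OF p(1) det]]
    by (simp_all add: mult.assoc)
  then have "?e * h i = ?e * h o1" "?e * h j = ?e * h o1"
    by (simp_all add: u_def v_def right_diff_distrib)
  \<comment> \<open>The scaled colouring agrees at the three generating crossings, so it is
    constant.\<close>
  then have "constant_mod 1 (\<lambda>c. ?e * h c) (?e * q) w"
    using rel runs_scale[OF runs, of ?e] unfolding two_generator_relations_def by blast
  with nonconst show False ..
qed

definition ipolys :: "int poly \<times> int poly \<times> int poly \<times> int poly \<Rightarrow> 'r::comm_ring_1 \<Rightarrow> 'r \<times> 'r \<times> 'r \<times> 'r" where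
  "ipolys = (\<lambda>(f11, f12, f21, f22) a. (ipoly f11 a, ipoly f12 a, ipoly f21 a, ipoly f22 a))"

lemma diagram_of_well_formed:
  assumes "diagram_of K D"
  shows "well_formed D"
  using assms by (simp add: diagram_of_def knot_diagram_def)

text \<open>
  The determinant of the relation matrix is divisible by \<open>p^2\<close> at every integer congruent to \<open>-1\<close>
  modulo \<open>p\<close>. By the last assumption it is not divisible by \<open>p^(n + 3)\<close>; since all entries are
  divisible by \<open>p\<close>, the \<open>p\<close>-part of the module at this integer is annihilated by \<open>p^(n + 1)\<close>.
\<close>

lemma knot_not_triangularizable:
  fixes p :: int and K D :: gauss_code and n :: nat
  assumes p: "prime p" and K: "well_formed K" "diagram_of K D"
    and types: "of_int p = (0::'f::comm_ring_1)" "(1::'f) \<noteq> 0"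
      "of_int (p ^ (n + 2)) = (0::'z::comm_ring_1)" "of_int (p ^ (n + 1)) \<noteq> (0::'z)"
    and f_col: "nontrivially_colourable (-1::'f) (-1) 1 K"
    and rel_dual: "\<And>a a' :: 'f dual. a * a' = 1 \<Longrightarrow> two_generator_relations a a' K g (ipolys (f11, f12, f21, f22) a)"
    and rel_adic: "\<And>a a' :: 'z. a * a' = 1 \<Longrightarrow> two_generator_relations a a' K g (ipolys (f11, f12, f21, f22) a)"
    and at_minus_1: "\<And>f. f \<in> {f11, f12, f21, f22} \<Longrightarrow> p dvd poly f (-1)"
    and deriv: "\<not> p dvd poly (pderiv f11) (-1) * poly (pderiv f22) (-1) - poly (pderiv f12) (-1) * poly (pderiv f21) (-1)"
    and det: "list_all (\<lambda>b. \<not> p ^ (n + 3) dvd poly (f11 * f22 - f12 * f21) (p * b - 1)) [0..p ^ (n + 2) - 1]"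
  shows "\<not> triangularizable (colouring_matrix D)"
proof -
  obtain o1 i j where g: "g = (o1, i, j)" by (cases g)
  have wf: "well_formed D" using K(2) by (rule diagram_of_well_formed)
  have dual0: "of_int p = (0::'f dual)"
    by (simp add: of_int_dual types(1) zero_dual_def)
  \<comment> \<open>Stated for every \<open>t\<close> of square zero, because exchanging
    \<open>-1 + s\<close> with its inverse replaces \<open>s\<close> by \<open>-s\<close>.\<close>
  have dual_col: "\<not> nontrivially_colourable (-1 + t) (-1 - t) t K" if t: "t * t = 0" for t :: "'f dual"
  proof -
    have inv: "(-1 + t) * (-1 - t) = 1" using t by (simp add: algebra_simps)
    have coeff: "ipoly f (-1 + t) = t * of_int (poly (pderiv f) (-1))" if "f \<in> {f11, f12, f21, f22}" for f
    proof -
      have "of_int (poly f (-1)) = (0::'f dual)"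
        using at_minus_1[OF that] dual0 by (auto elim!: dvdE)
      then show ?thesis using ipoly_nilpotent[OF t, of f "-1"] by simp
    qed
    \<comment> \<open>Dividing the entries by \<open>t\<close> leaves their derivatives at -1, whose
      determinant is the subject of \<open>deriv\<close>.\<close>
    have "\<not> nontrivially_colourable (-1 + t) (-1 - t) (of_int (p ^ 0) * t) K"
      by (rule not_colourable_by_cramer[OF rel_dual[OF inv, unfolded g ipolys_def prod.case] coeff coeff coeff coeff p])
        (use deriv dual0 in simp_all)
    then show ?thesis by simp
  qed
  have adic_col: "\<not> nontrivially_colourable (of_int x) a' (of_int (p ^ (n + 1))) K"
    if x: "[x = -1] (mod p)" and inv: "of_int x * a' = (1::'z)" for x a'
  proof -
    have "\<forall>f \<in> {f11, f12, f21, f22}. p dvd poly f x"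
      using at_minus_1 cong_dvd_iff[OF poly_cong[OF x]] by blast
    then obtain k11 k12 k21 k22 where k: "poly f11 x = p * k11" "poly f12 x = p * k12"
      "poly f21 x = p * k21" "poly f22 x = p * k22"
      by (auto simp: dvd_def)
    have "\<not> p ^ Suc n dvd k11 * k22 - k12 * k21"
    proof
      have pow: "p ^ (n + 3) = p * p * p ^ Suc n" by (simp add: eval_nat_numeral)
      assume "p ^ Suc n dvd k11 * k22 - k12 * k21"
      then have "p * p * p ^ Suc n dvd p * p * (k11 * k22 - k12 * k21)" by (rule mult_dvd_mono[OF dvd_refl])
      moreover have "p * p * (k11 * k22 - k12 * k21) = poly (f11 * f22 - f12 * f21) x"
        by (simp add: k algebra_simps)
      ultimately have *: "p ^ (n + 3) dvd poly (f11 * f22 - f12 * f21) x"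
        using pow by (simp only:)
      obtain b where b: "x = p * b - 1"
        using x by (auto simp: cong_iff_dvd_diff dvd_def algebra_simps)
      \<comment> \<open>Reducing \<open>b\<close> modulo \<open>p^(n+2)\<close> changes
        \<open>x\<close> by a multiple of \<open>p^(n+3)\<close>, so the finite list in
        \<open>det\<close> covers every \<open>x\<close>.\<close>
      let ?b = "b mod p ^ (n + 2)"
      have "p ^ (n + 3) dvd p * (b - ?b)"
        by (simp add: minus_mod_eq_mult_div eval_nat_numeral mult.assoc)
      then have "[x = p * ?b - 1] (mod p ^ (n + 3))"
        by (simp add: b cong_iff_dvd_diff right_diff_distrib)
      then have "p ^ (n + 3) dvd poly (f11 * f22 - f12 * f21) (p * ?b - 1)"
        using * cong_dvd_iff[OF poly_cong] by blast
      moreover have "?b \<in> set [0..p ^ (n + 2) - 1]"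
        using prime_gt_0_int[OF p] by (simp add: pos_mod_bound)
      ultimately show False using det unfolding list_all_iff by blast
    qed
    moreover have "of_int (p ^ Suc n) * of_int p = (0::'z)"
      using types(3) by (simp add: mult_ac)
    ultimately have "\<not> nontrivially_colourable (of_int x) a' (of_int (p ^ n) * of_int p) K"
      by (intro not_colourable_by_cramer[OF rel_adic[OF inv, unfolded g ipolys_def prod.case] _ _ _ _ p])
        (simp_all add: ipoly_of_int k)
    then show ?thesis by (simp add: mult.commute)
  qed
  let ?s = "Dual 0 1 :: 'f dual"
  show ?thesis
  proof (rule not_triangularizable_criterion[OF p wf types(1) _ dual0 eps_square _ _ types(3) _ types(4)])
    have "(-1::'f) * (-1) = 1" by simp
    from diagram_of_colourable[OF K(2,1) this] f_col
    show "nontrivially_colourable (-1::'f) (-1) 1 D" by blast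
    show "?s \<noteq> 0" using types(2) by (simp add: zero_dual_def)
    have inv: "(-1 + ?s) * (-1 - ?s) = 1" using eps_square by (simp add: algebra_simps)
    have "\<not> nontrivially_colourable (-1 + ?s) (-1 - ?s) ?s K"
      using dual_col[OF eps_square] .
    \<comment> \<open>\<open>s\<close> and \<open>-s\<close> have the same annihilator, hence define
      the same notion of constancy.\<close>
    moreover have "\<not> nontrivially_colourable (-1 - ?s) (-1 + ?s) ?s K"
      using dual_col[of "- ?s"] eps_square
      by (simp add: nontrivially_colourable_def constant_mod_def)
    ultimately show "\<not> nontrivially_colourable (-1 + ?s) (-1 - ?s) ?s D"
      using diagram_of_colourable[OF K(2,1) inv] by blast
    fix x and a' :: 'z assume x: "[x = -1] (mod p)" and inv: "of_int x * a' = 1"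
    have "\<not> p dvd x"
      using x p by (metis cong_dvd_iff dvd_minus_iff not_prime_unit)
    then have "coprime p x" by (rule prime_imp_coprime[OF p])
    then have "coprime x (p ^ (n + 2))" by (simp add: coprime_commute)
    \<comment> \<open>The inverse of \<open>x\<close> is again the image of an integer congruent to
      -1 modulo \<open>p\<close>, so \<open>adic_col\<close> also covers the exchanged pair.\<close>
    then obtain y where y: "[x * y = 1] (mod p ^ (n + 2))" using cong_solve_coprime_int by blast
    then obtain r where "x * y = 1 + p ^ (n + 2) * r" by (metis cong_iff_lin cong_sym)
    then have "of_int (x * y) = (1::'z)" using types(3) by simp
    then have "a' = of_int y"
      using inv by (metis mult.assoc mult.commute mult.right_neutral of_int_mult)
    moreover have "[y = -1] (mod p)"
    proof -
      have "[x * y = 1] (mod p)"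
        using y by (rule cong_dvd_modulus) simp
      moreover have "[x * y = -1 * y] (mod p)" using x by (rule cong_scalar_right)
      ultimately have "[-1 * y = 1] (mod p)" by (metis cong_sym cong_trans)
      then show ?thesis using cong_minus_minus_iff by fastforce
    qed
    ultimately have "\<not> nontrivially_colourable a' (of_int x) (of_int (p ^ (n + 1))) K"
      using adic_col[of y "of_int x"] inv by (simp add: mult.commute)
    then show "\<not> nontrivially_colourable (of_int x) a' (of_int (p ^ (n + 1))) D"
      using adic_col[OF x inv] diagram_of_colourable[OF K(2,1) inv] by blast
  qed simp
qed

section \<open>Numerical verification for the five knots\<close>

lemma knot_9_35_generators:
  fixes a a' :: "'r::comm_ring_1"
  assumes "a * a' = 1"
  shows "two_generator_relations a a' knot_9_35 (4, 5, 9)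
    (ipolys ([:2, -1:], [:1, -2:], [:1, -2:], [:-3, 3:]) a)"
  unfolding two_generator_relations_def ipolys_def prod.case
  using knot_9_35_relations[OF _ assms] knot_9_35_constant[OF _ assms]
  by (auto simp: algebra_simps eval_nat_numeral)

text \<open>The determinant is -27 at -1, so \<open>3^3\<close> cannot be excluded as a divisor but
  \<open>3^4\<close> can; hence \<open>n = 1\<close>, with the integers modulo 27 as the adic
  ring.\<close>

lemma knot_9_35_not_triangularizable:
  assumes "diagram_of knot_9_35 D"
  shows "\<not> triangularizable (colouring_matrix D)"
proof (rule knot_not_triangularizable[where p = 3 and n = 1 and K = knot_9_35 and g = "(4, 5, 9)"
      and ?f11.0 = "[:2, -1:]" and ?f12.0 = "[:1, -2:]"
      and ?f21.0 = "[:1, -2:]" and ?f22.0 = "[:-3, 3:]"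
      and 'f = 3 and 'z = 27])
  show "nontrivially_colourable (-1 :: 3) (-1) 1 knot_9_35"
    unfolding nontrivially_colourable_def
    \<comment> \<open>A Fox 3-colouring: entry \<open>c\<close> is the colour of the upper strand at
      crossing \<open>c\<close>. Labels start at 1, so entry 0 is a filler.\<close>
    by (rule exI[of _ "nth [0, 0, 0, 0, 0, 0, 2, 1, 2, 1]"], rule exI[of _ 0])
      (simp add: knot_9_35_def signed_code_def quandle_op_def)
  show "well_formed knot_9_35" using knot_diagram_9_35 by (simp add: knot_diagram_def)
  show "two_generator_relations a a' knot_9_35 (4, 5, 9) (ipolys ([:2, -1:], [:1, -2:], [:1, -2:], [:-3, 3:]) a)"
    if "a * a' = 1" for a a' :: "3 dual"
    using that by (rule knot_9_35_generators)
  show "two_generator_relations a a' knot_9_35 (4, 5, 9) (ipolys ([:2, -1:], [:1, -2:], [:1, -2:], [:-3, 3:]) a)"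
    if "a * a' = 1" for a a' :: 27
    using that by (rule knot_9_35_generators)
  show "list_all (\<lambda>b. \<not> 3 ^ (1 + 3) dvd
      poly ([:2, -1:] * [:-3, 3:] - [:1, -2:] * [:1, -2:]) (3 * b - 1 :: int)) [0..3 ^ (1 + 2) - 1]"
    by (simp add: upto_rec1)
qed (use assms in \<open>auto simp: pderiv_pCons\<close>)

lemma knot_9_47_generators:
  fixes a a' :: "'r::comm_ring_1"
  assumes "a * a' = 1"
  shows "two_generator_relations a a' knot_9_47 (7, 3, 2)
    (ipolys ([:1, -2:], [:-1, 2, -2, 1:], [:0, 0, 2, -1:], [:1, -2:]) a)"
  unfolding two_generator_relations_def ipolys_def prod.case
  using knot_9_47_relations[OF _ assms] knot_9_47_constant[OF _ assms]
  by (auto simp: algebra_simps eval_nat_numeral)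

text \<open>The determinant is 27 at -1, which again leads to \<open>n = 1\<close>.\<close>

lemma knot_9_47_not_triangularizable:
  assumes "diagram_of knot_9_47 D"
  shows "\<not> triangularizable (colouring_matrix D)"
proof (rule knot_not_triangularizable[where p = 3 and n = 1 and K = knot_9_47 and g = "(7, 3, 2)"
      and ?f11.0 = "[:1, -2:]" and ?f12.0 = "[:-1, 2, -2, 1:]"
      and ?f21.0 = "[:0, 0, 2, -1:]" and ?f22.0 = "[:1, -2:]"
      and 'f = 3 and 'z = 27])
  show "nontrivially_colourable (-1 :: 3) (-1) 1 knot_9_47"
    unfolding nontrivially_colourable_def
    by (rule exI[of _ "nth [0, 2, 1, 0, 2, 1, 0, 0, 2, 2]"], rule exI[of _ 2])
      (simp add: knot_9_47_def signed_code_def quandle_op_def)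
  show "well_formed knot_9_47" using knot_diagram_9_47 by (simp add: knot_diagram_def)
  show "two_generator_relations a a' knot_9_47 (7, 3, 2) (ipolys ([:1, -2:], [:-1, 2, -2, 1:], [:0, 0, 2, -1:], [:1, -2:]) a)"
    if "a * a' = 1" for a a' :: "3 dual"
    using that by (rule knot_9_47_generators)
  show "two_generator_relations a a' knot_9_47 (7, 3, 2) (ipolys ([:1, -2:], [:-1, 2, -2, 1:], [:0, 0, 2, -1:], [:1, -2:]) a)"
    if "a * a' = 1" for a a' :: 27
    using that by (rule knot_9_47_generators)
  show "list_all (\<lambda>b. \<not> 3 ^ (1 + 3) dvd
      poly ([:1, -2:] * [:1, -2:] - [:-1, 2, -2, 1:] * [:0, 0, 2, -1:]) (3 * b - 1 :: int)) [0..3 ^ (1 + 2) - 1]"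
    by (simp add: upto_rec1)
qed (use assms in \<open>auto simp: pderiv_pCons\<close>)

lemma knot_9_48_generators:
  fixes a a' :: "'r::comm_ring_1"
  assumes "a * a' = 1"
  shows "two_generator_relations a a' knot_9_48 (1, 5, 2)
    (ipolys ([:-1, 2:], [:1, 0, -1:], [:-1, 1, -1:], [:2, -4, 3:]) a)"
  unfolding two_generator_relations_def ipolys_def prod.case
  using knot_9_48_relations[OF _ assms] knot_9_48_constant[OF _ assms]
  by (auto simp: algebra_simps eval_nat_numeral)

text \<open>The determinant is -27 at -1, which again leads to \<open>n = 1\<close>.\<close>

lemma knot_9_48_not_triangularizable:
  assumes "diagram_of knot_9_48 D"
  shows "\<not> triangularizable (colouring_matrix D)"
proof (rule knot_not_triangularizable[where p = 3 and n = 1 and K = knot_9_48 and g = "(1, 5, 2)"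
      and ?f11.0 = "[:-1, 2:]" and ?f12.0 = "[:1, 0, -1:]"
      and ?f21.0 = "[:-1, 1, -1:]" and ?f22.0 = "[:2, -4, 3:]"
      and 'f = 3 and 'z = 27])
  show "nontrivially_colourable (-1 :: 3) (-1) 1 knot_9_48"
    unfolding nontrivially_colourable_def
    by (rule exI[of _ "nth [0, 0, 1, 2, 2, 0, 1, 1, 0, 2]"], rule exI[of _ 0])
      (simp add: knot_9_48_def signed_code_def quandle_op_def)
  show "well_formed knot_9_48" using knot_diagram_9_48 by (simp add: knot_diagram_def)
  show "two_generator_relations a a' knot_9_48 (1, 5, 2) (ipolys ([:-1, 2:], [:1, 0, -1:], [:-1, 1, -1:], [:2, -4, 3:]) a)"
    if "a * a' = 1" for a a' :: "3 dual"
    using that by (rule knot_9_48_generators)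
  show "two_generator_relations a a' knot_9_48 (1, 5, 2) (ipolys ([:-1, 2:], [:1, 0, -1:], [:-1, 1, -1:], [:2, -4, 3:]) a)"
    if "a * a' = 1" for a a' :: 27
    using that by (rule knot_9_48_generators)
  show "list_all (\<lambda>b. \<not> 3 ^ (1 + 3) dvd
      poly ([:-1, 2:] * [:2, -4, 3:] - [:1, 0, -1:] * [:-1, 1, -1:]) (3 * b - 1 :: int)) [0..3 ^ (1 + 2) - 1]"
    by (simp add: upto_rec1)
qed (use assms in \<open>auto simp: pderiv_pCons\<close>)

lemma knot_9_49_generators:
  fixes a a' :: "'r::comm_ring_1"
  assumes "a * a' = 1"
  shows "two_generator_relations a a' knot_9_49 (1, 6, 9)
    (ipolys ([:2, -2, 1:], [:-1, 0, 1:], [:-1, 0, 1:], [:-1, 2, -2:]) a)"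
  unfolding two_generator_relations_def ipolys_def prod.case
  using knot_9_49_relations[OF _ assms] knot_9_49_constant[OF _ assms]
  by (auto simp: algebra_simps eval_nat_numeral)

text \<open>The determinant is -25 at -1, and \<open>5^3\<close> divides none of its values at
  integers congruent to -1 modulo 5; so \<open>n = 0\<close> suffices.\<close>

lemma knot_9_49_not_triangularizable:
  assumes "diagram_of knot_9_49 D"
  shows "\<not> triangularizable (colouring_matrix D)"
proof (rule knot_not_triangularizable[where p = 5 and n = 0 and K = knot_9_49 and g = "(1, 6, 9)"
      and ?f11.0 = "[:2, -2, 1:]" and ?f12.0 = "[:-1, 0, 1:]"
      and ?f21.0 = "[:-1, 0, 1:]" and ?f22.0 = "[:-1, 2, -2:]"
      and 'f = 5 and 'z = 25])
  show "nontrivially_colourable (-1 :: 5) (-1) 1 knot_9_49"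
    unfolding nontrivially_colourable_def
    by (rule exI[of _ "nth [0, 0, 0, 1, 2, 1, 0, 0, 3, 1]"], rule exI[of _ 0])
      (simp add: knot_9_49_def signed_code_def quandle_op_def)
  show "well_formed knot_9_49" using knot_diagram_9_49 by (simp add: knot_diagram_def)
  show "two_generator_relations a a' knot_9_49 (1, 6, 9) (ipolys ([:2, -2, 1:], [:-1, 0, 1:], [:-1, 0, 1:], [:-1, 2, -2:]) a)"
    if "a * a' = 1" for a a' :: "5 dual"
    using that by (rule knot_9_49_generators)
  show "two_generator_relations a a' knot_9_49 (1, 6, 9) (ipolys ([:2, -2, 1:], [:-1, 0, 1:], [:-1, 0, 1:], [:-1, 2, -2:]) a)"
    if "a * a' = 1" for a a' :: 25
    using that by (rule knot_9_49_generators)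
  show "list_all (\<lambda>b. \<not> 5 ^ (0 + 3) dvd
      poly ([:2, -2, 1:] * [:-1, 2, -2:] - [:-1, 0, 1:] * [:-1, 0, 1:]) (5 * b - 1 :: int)) [0..5 ^ (0 + 2) - 1]"
    by (simp add: upto_rec1)
qed (use assms in \<open>auto simp: pderiv_pCons\<close>)

lemma knot_10_157_generators:
  fixes a a' :: "'r::comm_ring_1"
  assumes "a * a' = 1"
  shows "two_generator_relations a a' knot_10_157 (3, 2, 5)
    (ipolys ([:-1, 0, 1:], [:1, -3, 2, -1:], [:-1, 3, -3:], [:0, 0, 3, -3, 1:]) a)"
  unfolding two_generator_relations_def ipolys_def prod.case
  using knot_10_157_relations[OF _ assms] knot_10_157_constant[OF _ assms]
  by (auto simp: algebra_simps eval_nat_numeral)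

text \<open>The determinant is 49 at -1, and \<open>7^3\<close> divides none of its values at
  integers congruent to -1 modulo 7; so \<open>n = 0\<close> suffices.\<close>

lemma knot_10_157_not_triangularizable:
  assumes "diagram_of knot_10_157 D"
  shows "\<not> triangularizable (colouring_matrix D)"
proof (rule knot_not_triangularizable[where p = 7 and n = 0 and K = knot_10_157 and g = "(3, 2, 5)"
      and ?f11.0 = "[:-1, 0, 1:]" and ?f12.0 = "[:1, -3, 2, -1:]"
      and ?f21.0 = "[:-1, 3, -3:]" and ?f22.0 = "[:0, 0, 3, -3, 1:]"
      and 'f = 7 and 'z = 49])
  show "nontrivially_colourable (-1 :: 7) (-1) 1 knot_10_157"
    unfolding nontrivially_colourable_def
    by (rule exI[of _ "nth [0, 0, 0, 0, 0, 1, 2, 0, 5, 6, 4]"], rule exI[of _ 0])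
      (simp add: knot_10_157_def signed_code_def quandle_op_def)
  show "well_formed knot_10_157" using knot_diagram_10_157 by (simp add: knot_diagram_def)
  show "two_generator_relations a a' knot_10_157 (3, 2, 5) (ipolys ([:-1, 0, 1:], [:1, -3, 2, -1:], [:-1, 3, -3:], [:0, 0, 3, -3, 1:]) a)"
    if "a * a' = 1" for a a' :: "7 dual"
    using that by (rule knot_10_157_generators)
  show "two_generator_relations a a' knot_10_157 (3, 2, 5) (ipolys ([:-1, 0, 1:], [:1, -3, 2, -1:], [:-1, 3, -3:], [:0, 0, 3, -3, 1:]) a)"
    if "a * a' = 1" for a a' :: 49
    using that by (rule knot_10_157_generators)
  show "list_all (\<lambda>b. \<not> 7 ^ (0 + 3) dvd
      poly ([:-1, 0, 1:] * [:0, 0, 3, -3, 1:] - [:1, -3, 2, -1:] * [:-1, 3, -3:]) (7 * b - 1 :: int)) [0..7 ^ (0 + 2) - 1]"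
    by (simp add: upto_rec1)
qed (use assms in \<open>auto simp: pderiv_pCons\<close>)

theorem proposition22:
  fixes K D :: gauss_code
  assumes "K \<in> {knot_9_35, knot_9_47, knot_9_48, knot_9_49, knot_10_157}"
    and "diagram_of K D"
    and "D \<noteq> []"
  shows "\<not> triangularizable (colouring_matrix D)"
  using assms(1,2) knot_9_35_not_triangularizable knot_9_47_not_triangularizable
    knot_9_48_not_triangularizable knot_9_49_not_triangularizable knot_10_157_not_triangularizable
  by blast

end
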